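(* Let $p>5$ be any prime congruent to $3$ or $7$ modulo $10$. Then, for integers $n\ge 0$, \begin{align*} C_0(n) &= 0 \qquad \text{if } \nu_p(30n+1)=1,\\ C_0\left(p^2 n + \tfrac{1}{30}(19p^2-1)\right) &= - \varepsilon_p\, C_1(n) \qquad \text{for } n \ge 0,\\ C_1(n) &= 0 \qquad \text{if } \nu_p(30n+19)=1,\\ C_1\left(p^2 n + \tfrac{1}{30}(p^2-19)\right) &= \varepsilon_p\, C_0(n) \qquad \text{for } n \ge 0. \end{align*}
   Context: Notation: for a nonnegative integer $n$, $(a;q)_n=(1-a)(1-aq)\cdots(1-aq^{n-1})$, and $(q)_\infty=\prod_{n=1}^\infty(1-q^n)$. Ramanujan's fifth order mock theta functions $\chi_0,\chi_1$ are $$\chi_0(q)=\sum_{n=0}^\infty \frac{q^n}{(q^{n+1};q)_n},\qquad \chi_1(q)=\sum_{n=0}^\infty \frac{q^n}{(q^{n+1};q)_{n+1}},$$ regarded as power series in $q$. The coefficients $C_0(n)$, $C_1(n)$ are defined by $$\sum_{n=0}^\infty C_0(n) q^n = (q)_\infty\,(2-\chi_0(q)),\qquad \sum_{n=0}^\infty C_1(n) q^n = (q)_\infty\,\chi_1(q).$$ For a prime $p$, $\varepsilon_p=-1$ if $p\equiv 3\pmod{10}$ and $\varepsilon_p=1$ if $p\equiv 7\pmod{10}$. For a nonzero integer $N$, $\nu_p(N)$ denotes the exponent of the exact power of $p$ dividing $N$. *)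

theory Defs
  imports "HOL-Analysis.Analysis" "HOL-Computational_Algebra.Computational_Algebra"
begin

text \<open>
  All $q$-series are formal power series over the rationals with \<^const>\<open>fps_X\<close> for $q$, so that
  they can be divided by series with constant term 1. Infinite sums and products are those of
  the $X$-adic topology on \<^typ>\<open>rat fps\<close>; their convergence is proved below.
\<close>

definition qpoch :: "'a::comm_ring_1 \<Rightarrow> 'a \<Rightarrow> nat \<Rightarrow> 'a" where
  "qpoch a q n = (\<Prod>k<n. 1 - a * q ^ k)"

definition euler_fps :: "rat fps" where
  "euler_fps = prodinf (\<lambda>n. 1 - fps_X ^ Suc n)"

definition chi0 :: "rat fps" where
  "chi0 = (\<Sum>n. fps_X ^ n / qpoch (fps_X ^ (n + 1)) fps_X n)"

definition chi1 :: "rat fps" where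
  "chi1 = (\<Sum>n. fps_X ^ n / qpoch (fps_X ^ (n + 1)) fps_X (n + 1))"

definition C0 :: "nat \<Rightarrow> rat" where
  "C0 n = fps_nth (euler_fps * (2 - chi0)) n"

definition C1 :: "nat \<Rightarrow> rat" where
  "C1 n = fps_nth (euler_fps * chi1) n"

text \<open>Only meaningful for $p$ congruent to 3 or 7 modulo 10.\<close>

definition eps :: "nat \<Rightarrow> rat" where
  "eps p = (if p mod 10 = 3 then -1 else 1)"

lemma fps_nth_0_qpoch: "fps_nth (qpoch (fps_X ^ (n + 1)) fps_X m :: rat fps) 0 = 1"
  by (induction m) (simp_all add: qpoch_def)

lemma fps_sumsI:
  fixes f :: "nat \<Rightarrow> 'a::comm_ring_1 fps"
  assumes "\<And>n k. k < n \<Longrightarrow> fps_nth (f n) k = 0"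
  shows "f sums Abs_fps (\<lambda>k. \<Sum>n\<le>k. fps_nth (f n) k)"
  unfolding sums_def_le tendsto_fps_iff
proof
  fix k
  have "fps_nth (\<Sum>n\<le>N. f n) k = (\<Sum>n\<le>k. fps_nth (f n) k)" if "N \<ge> k" for N
    unfolding fps_sum_nth using that assms by (intro sum.mono_neutral_right) auto
  thus "\<forall>\<^sub>F N in sequentially. fps_nth (\<Sum>n\<le>N. f n) k
          = fps_nth (Abs_fps (\<lambda>k. \<Sum>n\<le>k. fps_nth (f n) k)) k"
    unfolding eventually_sequentially by (intro exI[of _ k]) simp
qed

lemma fps_nth_X_power_divide:
  fixes g :: "rat fps"
  assumes "fps_nth g 0 = 1" "k < n"
  shows "fps_nth (fps_X ^ n / g) k = 0"
  using assms by (simp add: fps_divide_unit fps_X_power_mult_nth)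

lemma chi0_sums: "(\<lambda>n. fps_X ^ n / qpoch (fps_X ^ (n + 1)) fps_X n) sums chi0"
  unfolding chi0_def
  by (intro summable_sums sums_summable[OF fps_sumsI] fps_nth_X_power_divide fps_nth_0_qpoch)

lemma chi1_sums: "(\<lambda>n. fps_X ^ n / qpoch (fps_X ^ (n + 1)) fps_X (n + 1)) sums chi1"
  unfolding chi1_def
  by (intro summable_sums sums_summable[OF fps_sumsI] fps_nth_X_power_divide fps_nth_0_qpoch)

lemma euler_fps_has_prod: "(\<lambda>n. 1 - fps_X ^ Suc n) has_prod euler_fps"
proof -
  define P :: "nat \<Rightarrow> rat fps" where "P N = (\<Prod>n\<le>N. 1 - fps_X ^ Suc n)" for N
  define L where "L = Abs_fps (\<lambda>k. fps_nth (P k) k)"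
  have step: "fps_nth (P (Suc N)) k = fps_nth (P N) k" if "k \<le> N" for N k
  proof -
    have "P (Suc N) = P N - P N * fps_X ^ Suc (Suc N)"
      by (simp add: P_def algebra_simps)
    thus ?thesis using that
      by (simp add: fps_X_power_mult_right_nth del: power_Suc)
  qed
  have stable: "fps_nth (P N) k = fps_nth (P k) k" if "k \<le> N" for N k
    using that by (induction N rule: dec_induct) (simp_all add: step)
  have "P \<longlonglongrightarrow> L"
    unfolding tendsto_fps_iff eventually_sequentially L_def
    by (auto intro!: exI stable)
  moreover have "fps_nth L 0 = 1"
    by (simp add: L_def P_def)
  hence "L \<noteq> 0" by auto
  ultimately have "raw_has_prod (\<lambda>n. 1 - fps_X ^ Suc n) 0 L"
    by (simp add: raw_has_prod_def P_def[abs_def])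
  hence "(\<lambda>n. 1 - fps_X ^ Suc n) has_prod L"
    by (simp add: has_prod_def)
  thus ?thesis
    unfolding euler_fps_def using has_prod_unique by metis
qed

text \<open>The index shifts $(19p^2-1)/30$ and $(p^2-19)/30$ are exact over the natural numbers.\<close>

lemma shift_exact:
  fixes p :: nat
  assumes "prime p" "p > 5" "p mod 10 = 3 \<or> p mod 10 = 7"
  shows "30 dvd 19 * p\<^sup>2 - 1" "30 dvd p\<^sup>2 - 19" "p\<^sup>2 \<ge> 19"
proof -
  have "\<not> 3 dvd p"
    using assms(1,2) primes_dvd_imp_eq[of 3 p] by auto
  hence "p mod 30 \<in> {7, 13, 17, 23}"
    using assms(3) by auto presburger+
  hence sq: "p\<^sup>2 mod 30 = 19"
    by (auto simp: power_mod[of p 30 2, symmetric])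
  have "5 * 5 \<le> p * p"
    using assms(2) by (intro mult_mono) auto
  thus "p\<^sup>2 \<ge> 19"
    by (simp add: power2_eq_square)
  show "30 dvd 19 * p\<^sup>2 - 1" "30 dvd p\<^sup>2 - 19"
    using sq by presburger+
qed

end

theory Submission
  imports Defs "HOL-Number_Theory.Quadratic_Reciprocity"
begin

text \<open>
  Write $a_N = \pm q^{N(2N+1)/3}$ for $N \equiv 0, 1$ modulo 3 (signs $+$, $-$) and $a_N = 0$ otherwise.
  Schur's identity $\sum_N a_N / ((q)_{n-N} (q)_{n+N+c}) = 1 / (q)_{2n+c}$, for $c = 0, 1$, turns
  $(q)_\infty \chi_c$ into $\sum_N a_N \gamma_N$ with
  $\gamma_N = (q)_\infty \sum_n q^n (q)_n / ((q)_{n-N} (q)_{n+N+c})$. By the $q$-binomial theorem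
  $\gamma_N$ is expressed through $\sum_k (x)_k x^k$ at $x = q^{N+1}$, which the argument of Euler's
  pentagonal number theorem evaluates as a partial theta series in $q^{M(3M \pm 1)/2}$, $M > N$.
  Completing squares with $u = 6M \pm 1$ and $v = 10N + 1$ (or $10N + 7$), both $C_0(n)$ and $C_1(n)$
  become the same signed count of solutions of $5u^2 - v^2 = 4m$ in the cone $3|v| < 5u$, with
  $m = 30n + 1$ respectively $m = 30n + 19$. Since the cone is homogeneous and $p$ is inert in
  $\mathbb{Q}(\sqrt 5)$, every solution for a multiple of $p$ is $p$ times a solution for $m / p^2$.
\<close>

section \<open>Formal sums and finite q-factorials\<close>

text \<open>For c = 1 the transform is a partial theta series outright; for c = 0 it carries a
  disturbing factor 1 - q^N. Replacing -a_N gamma_N by the wanted theta term leaves discrepancies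
  that cancel in pairs N, 1 - N, by the antisymmetry of a_N and the recursion of the theta series;
  only 2 (q)_inf survives, from the pair 0, 1. This is the 2 in 2 - chi_0.

  C_0 and C_1 change places because p^2 = 4 modulo 5, while 30n + 1 and 30n + 19 lie in the classes
  1 and 4. The delicate point is the sign of a solution: its factor in v is not a character, as it
  involves the half of the period 60 in which |v| lies. Multiplication by p exchanges this
  half-period sign with its twist by the Legendre symbol (v/5), up to a constant depending on p, and
  (v/5) is constant on the solutions for a given m. Hence all signs scale by one common
  factor.\<close>

definition fsum :: "(nat \<Rightarrow> rat fps) \<Rightarrow> rat fps" where
  "fsum g = Abs_fps (\<lambda>k. \<Sum>n\<le>k. fps_nth (g n) (k - n))"

lemma fsum_nth: "fps_nth (fsum g) k = (\<Sum>n\<le>k. fps_nth (g n) (k - n))"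
  by (simp add: fsum_def)

lemma fsum_nth_finite:
  assumes "k < K"
  shows "fps_nth (fsum g) k = fps_nth (\<Sum>n<K. fps_X ^ n * g n) k"
proof -
  have "fps_nth (\<Sum>n<K. fps_X ^ n * g n) k = (\<Sum>n<K. if k < n then 0 else fps_nth (g n) (k - n))"
    by (simp add: fps_sum_nth fps_X_power_mult_nth)
  also have "\<dots> = (\<Sum>n\<le>k. fps_nth (g n) (k - n))"
    using assms by (intro sum.mono_neutral_cong_right) auto
  finally show ?thesis by (simp add: fsum_nth)
qed

lemma fsum_shift: "fsum g = g 0 + fps_X * fsum (\<lambda>n. g (Suc n))"
proof (rule fps_ext)
  fix k
  show "fps_nth (fsum g) k = fps_nth (g 0 + fps_X * fsum (\<lambda>n. g (Suc n))) k"
    by (cases k) (simp_all add: fsum_nth sum.atMost_Suc_shift del: sum.atMost_Suc)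
qed

lemma fsum_drop:
  assumes "\<And>n. n < N \<Longrightarrow> g n = 0"
  shows "fsum g = fps_X ^ N * fsum (\<lambda>n. g (N + n))"
  using assms
proof (induction N arbitrary: g)
  case (Suc N)
  have "fsum g = fps_X * fsum (\<lambda>n. g (Suc n))"
    using Suc.prems[of 0] by (subst fsum_shift) simp
  also have "fsum (\<lambda>n. g (Suc n)) = fps_X ^ N * fsum (\<lambda>n. g (Suc (N + n)))"
    using Suc.prems by (intro Suc.IH) auto
  finally show ?case by (simp add: mult.assoc)
qed simp

lemma fsum_add: "fsum (\<lambda>n. f n + g n) = fsum f + fsum g"
  by (rule fps_ext) (simp add: fsum_nth sum.distrib)

lemma fsum_diff: "fsum (\<lambda>n. f n - g n) = fsum f - fsum g"
  by (rule fps_ext) (simp add: fsum_nth sum_subtractf)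

lemma triangle_swap:
  fixes h :: "nat \<Rightarrow> nat \<Rightarrow> 'a::comm_monoid_add"
  shows "(\<Sum>i\<le>k. \<Sum>j\<le>k - i. h i j) = (\<Sum>j\<le>k. \<Sum>i\<le>k - j. h i j)"
  unfolding sum.Sigma[OF finite_atMost ballI[OF finite_atMost]]
  by (rule sum.reindex_bij_witness[where i="\<lambda>(a,b). (b,a)" and j="\<lambda>(a,b). (b,a)"]) auto

lemma fsum_mult_left: "fsum (\<lambda>n. c * g n) = c * fsum g"
proof (rule fps_ext)
  fix k
  have "fps_nth (c * fsum g) k = (\<Sum>i\<le>k. \<Sum>n\<le>k - i. fps_nth c i * fps_nth (g n) (k - i - n))"
    by (simp add: fps_mult_nth fsum_nth sum_distrib_left atLeast0AtMost)
  also have "\<dots> = (\<Sum>n\<le>k. \<Sum>i\<le>k - n. fps_nth c i * fps_nth (g n) (k - i - n))"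
    by (rule triangle_swap)
  also have "\<dots> = fps_nth (fsum (\<lambda>n. c * g n)) k"
    by (simp add: fps_mult_nth fsum_nth atLeast0AtMost add.commute)
  finally show "fps_nth (fsum (\<lambda>n. c * g n)) k = fps_nth (c * fsum g) k" ..
qed

lemma fsum_swap: "fsum (\<lambda>i. fsum (\<lambda>j. h i j)) = fsum (\<lambda>j. fsum (\<lambda>i. h i j))"
proof (rule fps_ext)
  fix k
  show "fps_nth (fsum (\<lambda>i. fsum (\<lambda>j. h i j))) k = fps_nth (fsum (\<lambda>j. fsum (\<lambda>i. h i j))) k"
    using triangle_swap[of "\<lambda>i j. fps_nth (h i j) (k - i - j)" k]
    by (simp add: fsum_nth add.commute)
qed

section \<open>Finite q-factorials and their reciprocals\<close>

definition qfact :: "nat \<Rightarrow> rat fps" where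
  "qfact n = qpoch fps_X fps_X n"

text \<open>The usual convention 1/(q)_m = 0 for m < 0. It keeps the recursion valid at m = 0 and
  lets sums over all integers N terminate by themselves.\<close>

definition inv_qfact :: "int \<Rightarrow> rat fps" where
  "inv_qfact m = (if m < 0 then 0 else inverse (qfact (nat m)))"

lemma qfact_0 [simp]: "qfact 0 = 1"
  by (simp add: qfact_def qpoch_def)

lemma qfact_Suc: "qfact (Suc n) = qfact n * (1 - fps_X ^ Suc n)"
  by (simp add: qfact_def qpoch_def)

lemma qfact_nth_0 [simp]: "fps_nth (qfact n) 0 = 1"
  by (induction n) (simp_all add: qfact_Suc)

lemma qfact_nonzero [simp]: "qfact n \<noteq> 0"
  using qfact_nth_0[of n] by (metis fps_zero_nth zero_neq_one)

lemma inv_qfact_neg: "m < 0 \<Longrightarrow> inv_qfact m = 0"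
  by (simp add: inv_qfact_def)

lemma qfact_mult_inv_qfact [simp]: "qfact n * inv_qfact (int n) = 1"
  by (simp add: inv_qfact_def inverse_mult_eq_1')

lemma inv_qfact_mult_qfact [simp]: "inv_qfact (int n) * qfact n = 1"
  using qfact_mult_inv_qfact[of n] by (simp add: mult.commute)

lemma inv_qfact_0 [simp]: "inv_qfact 0 = 1"
  using qfact_mult_inv_qfact[of 0] by simp

lemma inv_qfact_step:
  assumes "0 \<le> m"
  shows "(1 - fps_X ^ nat m) * inv_qfact m = inv_qfact (m - 1)"
proof (cases "m = 0")
  case False
  then obtain n where n: "m = int (Suc n)"
    using assms by (metis not0_implies_Suc nonneg_int_cases of_nat_0)
  have "qfact (Suc n) * ((1 - fps_X ^ Suc n) * inv_qfact (int (Suc n))) = (1 - fps_X ^ Suc n) * (qfact (Suc n) * inv_qfact (int (Suc n)))"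
    by (simp only: ac_simps)
  also have "\<dots> = (1 - fps_X ^ Suc n) * (qfact n * inv_qfact (int n))"
    by (simp only: qfact_mult_inv_qfact)
  also have "\<dots> = qfact (Suc n) * inv_qfact (int n)"
    by (simp add: qfact_Suc ac_simps)
  finally show ?thesis using n
    by (simp del: of_nat_Suc power_Suc) simp
qed (simp add: inv_qfact_neg)

lemma qpoch_mult_qfact: "qfact n * qpoch (fps_X ^ (n + 1)) fps_X m = qfact (n + m)"
proof (induction m)
  case (Suc m)
  have "qfact n * qpoch (fps_X ^ (n + 1)) fps_X (Suc m) =
    (qfact n * qpoch (fps_X ^ (n + 1)) fps_X m) * (1 - fps_X ^ Suc (n + m))"
    by (simp add: qpoch_def power_add mult_ac)
  thus ?case using Suc by (simp add: qfact_Suc)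
qed (simp add: qpoch_def)

text \<open>Brings the summands of chi_0 and chi_1 into the form (q)_n beta_n with beta_n =
  1/(q)_{2n+c}, to which the Bailey transform applies.\<close>

lemma divide_qpoch:
  "fps_X ^ n / qpoch (fps_X ^ (n + 1)) fps_X m = fps_X ^ n * (qfact n * inv_qfact (int (n + m)))"
proof -
  have "fps_X ^ n * (qfact n * inv_qfact (int (n + m))) * qpoch (fps_X ^ (n + 1)) fps_X m
     = fps_X ^ n * (inv_qfact (int (n + m)) * (qfact n * qpoch (fps_X ^ (n + 1)) fps_X m))"
    by (simp only: ac_simps)
  also have "\<dots> = fps_X ^ n"
    by (simp only: qpoch_mult_qfact inv_qfact_mult_qfact mult_1_right)
  finally have *: "fps_X ^ n * (qfact n * inv_qfact (int (n + m))) * qpoch (fps_X ^ (n + 1)) fps_X m = fps_X ^ n" .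
  have "qpoch (fps_X ^ (n + 1)) fps_X m \<noteq> (0 :: rat fps)"
    using fps_nth_0_qpoch[of n m] by (metis fps_zero_nth zero_neq_one)
  thus ?thesis using * by (metis nonzero_mult_div_cancel_right)
qed

text \<open>Links \<open>fsum\<close> to the topological sums in \<open>chi0\<close> and
  \<open>chi1\<close>. With q^n built in, every coefficient is a finite sum, so linearity and
  interchange of sums need no convergence argument.\<close>

lemma sums_fsum: "(\<lambda>n. fps_X ^ n * g n) sums fsum g"
proof -
  have "(\<lambda>n. fps_X ^ n * g n) sums Abs_fps (\<lambda>k. \<Sum>n\<le>k. fps_nth (fps_X ^ n * g n) k)"
    by (rule fps_sumsI) (simp add: fps_X_power_mult_nth)
  also have "Abs_fps (\<lambda>k. \<Sum>n\<le>k. fps_nth (fps_X ^ n * g n) k) = fsum g"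
    unfolding fsum_def by (simp add: fps_X_power_mult_nth cong: sum.cong_simp)
  finally show ?thesis .
qed

lemma chi0_fsum: "chi0 = fsum (\<lambda>n. qfact n * inv_qfact (int (n + n)))"
  by (rule sums_unique2[OF chi0_sums[unfolded divide_qpoch] sums_fsum])

lemma chi1_fsum: "chi1 = fsum (\<lambda>n. qfact n * inv_qfact (int (n + (n + 1))))"
  by (rule sums_unique2[OF chi1_sums[unfolded divide_qpoch] sums_fsum])

text \<open>Factors 1 - q^i with i > K do not touch coefficients up to K, so the infinite product
  may be replaced by a finite one in each degree.\<close>

lemma euler_fps_nth:
  assumes "k \<le> K"
  shows "fps_nth euler_fps k = fps_nth (qfact K) k"
proof -
  have qfact: "(\<Prod>n\<le>N. 1 - fps_X ^ Suc n) = qfact (Suc N)" for N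
    by (induction N) (simp_all add: qfact_Suc)
  have "(\<lambda>N. \<Prod>n\<le>N. 1 - fps_X ^ Suc n :: rat fps) \<longlonglongrightarrow> euler_fps"
    using euler_fps_has_prod by (rule has_prod_imp_tendsto)
  hence "\<forall>\<^sub>F N in sequentially. fps_nth (qfact (Suc N)) k = fps_nth euler_fps k"
    unfolding qfact tendsto_fps_iff by blast
  then obtain M where M: "\<And>N. N \<ge> M \<Longrightarrow> fps_nth (qfact (Suc N)) k = fps_nth euler_fps k"
    unfolding eventually_sequentially by blast
  have stable: "fps_nth (qfact N) k = fps_nth (qfact K) k" if "K \<le> N" for N
    using that
  proof (induction N rule: dec_induct)
    case (step N)
    have "qfact (Suc N) = qfact N - fps_X ^ Suc N * qfact N"
      by (simp add: qfact_Suc algebra_simps)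
    thus ?case using step assms by (simp add: fps_X_power_mult_nth del: power_Suc)
  qed simp
  from M[of "max K M"] stable[of "Suc (max K M)"] show ?thesis by simp
qed

section \<open>A conjugate Bailey pair\<close>

lemma fps_mult_nth_cong:
  assumes "\<And>i. i \<le> k \<Longrightarrow> fps_nth f i = fps_nth g i"
  shows "fps_nth (f * h) k = fps_nth (g * h) k"
  using assms by (simp add: fps_mult_nth)

section \<open>Euler's identity and the q-binomial theorem\<close>

lemma inv_qfact_Suc: "inv_qfact (int (Suc n)) * (1 - fps_X ^ Suc n) = inv_qfact (int n)"
  using inv_qfact_step[of "int (Suc n)"] unfolding nat_int by (simp add: mult.commute del: power_Suc)

lemma inv_qfact_sum_step:
  "fsum (\<lambda>s. inv_qfact (int s) * fps_X ^ (s * Suc k)) =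
   (1 - fps_X ^ Suc k) * fsum (\<lambda>s. inv_qfact (int s) * fps_X ^ (s * k))" (is "?e' = _ * ?e")
proof -
  have "?e - ?e' = fsum (\<lambda>s. (inv_qfact (int s) * (1 - fps_X ^ s)) * fps_X ^ (s * k))"
    unfolding fsum_diff[symmetric] by (simp add: algebra_simps power_add)
  also have "\<dots> = fps_X * fsum (\<lambda>s. (inv_qfact (int (Suc s)) * (1 - fps_X ^ Suc s)) * fps_X ^ (Suc s * k))"
    by (subst fsum_shift) simp
  also have "(\<lambda>s. (inv_qfact (int (Suc s)) * (1 - fps_X ^ Suc s)) * fps_X ^ (Suc s * k)) =
     (\<lambda>s. fps_X ^ k * (inv_qfact (int s) * fps_X ^ (s * k)))"
    by (simp only: inv_qfact_Suc) (simp add: power_add mult_ac)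
  finally have "?e - ?e' = fps_X ^ Suc k * ?e"
    by (simp only: fsum_mult_left power_Suc mult.assoc)
  moreover have "b = (1 - c) * a" if "a - b = c * a" for a b c :: "rat fps"
    using that by (simp add: algebra_simps)
  ultimately show ?thesis by blast
qed

text \<open>Euler's sum_s z^s/(q)_s = 1/(z;q)_inf at z = q^{k+1}. The functional equation gives e(k)
  = (q)_k e(0), and e(k) tends to 1 as k grows, which fixes e(0) = 1/(q)_inf.\<close>

lemma euler_inv_qfact_sum:
  "euler_fps * fsum (\<lambda>s. inv_qfact (int s) * fps_X ^ (s * k)) = qfact k"
proof -
  define e where "e k = fsum (\<lambda>s. inv_qfact (int s) * fps_X ^ (s * k))" for k
  have e: "e k = qfact k * e 0" for k
    by (induction k) (simp_all only: e_def inv_qfact_sum_step qfact_Suc qfact_0 mult_1_left ac_simps)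
  have "euler_fps * e 0 = 1"
  proof (rule fps_ext)
    fix m
    have "fps_nth (euler_fps * e 0) m = fps_nth (qfact (Suc m) * e 0) m"
      by (intro fps_mult_nth_cong euler_fps_nth) simp
    also have "qfact (Suc m) * e 0 = e (Suc m)"
      using e[of "Suc m"] ..
    \<comment> \<open>Only the summand 0 reaches degree m: the summand n >= 1 starts at degree n (m
      + 2).\<close>
    also have "fps_nth (e (Suc m)) m = fps_nth (1 :: rat fps) m + (\<Sum>n\<in>{..m} - {0}. fps_nth (inv_qfact (int n) * fps_X ^ (n * Suc m)) (m - n))"
      unfolding e_def fsum_nth by (subst sum.remove[of _ 0]) simp_all
    also have "(\<Sum>n\<in>{..m} - {0}. fps_nth (inv_qfact (int n) * fps_X ^ (n * Suc m)) (m - n)) = 0"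
    proof (intro sum.neutral ballI)
      fix n assume "n \<in> {..m} - {0}"
      hence "m - n < n * Suc m" by (cases n) auto
      thus "fps_nth (inv_qfact (int n) * fps_X ^ (n * Suc m)) (m - n) = 0"
        by (simp add: fps_X_power_mult_right_nth)
    qed
    finally show "fps_nth (euler_fps * e 0) m = fps_nth 1 m" by simp
  qed
  moreover have "euler_fps * e k = qfact k * (euler_fps * e 0)"
    by (subst e[of k]) (simp only: ac_simps)
  ultimately have "euler_fps * e k = qfact k"
    by simp
  thus ?thesis by (simp only: e_def)
qed

lemma qpoch_0 [simp]: "qpoch a q 0 = 1"
  by (simp add: qpoch_def)

lemma qpoch_Suc: "qpoch a q (Suc k) = qpoch a q k * (1 - a * q ^ k)"
  by (simp add: qpoch_def)

lemma qpoch_Suc_shift: "qpoch a q (Suc k) = (1 - a) * qpoch (a * q) q k"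
  unfolding qpoch_def by (subst prod.lessThan_Suc_shift) (simp add: mult.assoc)

lemma qpoch_X_Suc_shift: "qpoch (fps_X ^ j) fps_X (Suc k) = (1 - fps_X ^ j) * qpoch (fps_X ^ Suc j) fps_X k"
  unfolding qpoch_Suc_shift by (simp add: mult.commute)

text \<open>The q-binomial theorem at z = q^{m+1}, where the quotient of infinite products is
  finite. The difference of the sums for j + 1 and j contains 1 - q^{k+1}, which cancels against
  1/(q)_{k+1} and reproduces the sum for j + 1. At j = 0 only k = 0 survives.\<close>

lemma q_binomial:
  "fsum (\<lambda>k. qpoch (fps_X ^ j) fps_X k * inv_qfact (int k) * fps_X ^ (m * k)) =
   qfact m * inv_qfact (int (m + j))"
proof -
  define b where "b j = fsum (\<lambda>k. qpoch (fps_X ^ j) fps_X k * inv_qfact (int k) * fps_X ^ (m * k))" for j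
  have step: "b j = (1 - fps_X ^ Suc (m + j)) * b (Suc j)" for j
  proof -
    have "b (Suc j) - b j = fsum (\<lambda>k. (qpoch (fps_X ^ Suc j) fps_X k - qpoch (fps_X ^ j) fps_X k) * inv_qfact (int k) * fps_X ^ (m * k))"
      unfolding b_def fsum_diff[symmetric] by (simp only: left_diff_distrib)
    also have "\<dots> = fps_X * fsum (\<lambda>k. (qpoch (fps_X ^ Suc j) fps_X (Suc k) - qpoch (fps_X ^ j) fps_X (Suc k)) * inv_qfact (int (Suc k)) * fps_X ^ (m * Suc k))"
      by (subst fsum_shift) simp
    also have "(\<lambda>k. (qpoch (fps_X ^ Suc j) fps_X (Suc k) - qpoch (fps_X ^ j) fps_X (Suc k)) * inv_qfact (int (Suc k)) * fps_X ^ (m * Suc k))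
       = (\<lambda>k. fps_X ^ (m + j) * (qpoch (fps_X ^ Suc j) fps_X k * inv_qfact (int k) * fps_X ^ (m * k)))"
    proof
      fix k
      have "qpoch (fps_X ^ Suc j) fps_X (Suc k) - qpoch (fps_X ^ j) fps_X (Suc k) =
          fps_X ^ j * qpoch (fps_X ^ Suc j) fps_X k * (1 - fps_X ^ Suc k :: rat fps)"
        unfolding qpoch_X_Suc_shift[of j] qpoch_Suc[of "fps_X ^ Suc j"] by (simp add: algebra_simps)
      hence "(qpoch (fps_X ^ Suc j) fps_X (Suc k) - qpoch (fps_X ^ j) fps_X (Suc k)) * inv_qfact (int (Suc k)) * fps_X ^ (m * Suc k)
        = fps_X ^ j * qpoch (fps_X ^ Suc j) fps_X k * (inv_qfact (int (Suc k)) * (1 - fps_X ^ Suc k)) * fps_X ^ (m * Suc k)"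
        by (simp only: ac_simps)
      also have "\<dots> = fps_X ^ (m + j) * (qpoch (fps_X ^ Suc j) fps_X k * inv_qfact (int k) * fps_X ^ (m * k))"
        by (simp only: inv_qfact_Suc) (simp add: power_add mult_ac)
      finally show "(qpoch (fps_X ^ Suc j) fps_X (Suc k) - qpoch (fps_X ^ j) fps_X (Suc k)) * inv_qfact (int (Suc k)) * fps_X ^ (m * Suc k)
        = fps_X ^ (m + j) * (qpoch (fps_X ^ Suc j) fps_X k * inv_qfact (int k) * fps_X ^ (m * k))" .
    qed
    finally have "b (Suc j) - b j = fps_X ^ Suc (m + j) * b (Suc j)"
      unfolding fsum_mult_left by (simp only: b_def power_Suc mult.assoc)
    moreover have "b = (1 - c) * a" if "a - b = c * a" for a b c :: "rat fps"
      using that by (simp add: algebra_simps)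
    ultimately show ?thesis by blast
  qed
  have b0: "b 0 = 1"
    unfolding b_def by (subst fsum_shift) (simp add: qpoch_Suc_shift fsum_def fps_zero_def[symmetric])
  have "qfact (m + j) * b j = qfact m"
  proof (induction j)
    case (Suc j)
    have "qfact (m + Suc j) * b (Suc j) = qfact (m + j) * b j"
      unfolding step[of j] by (simp add: qfact_Suc mult_ac)
    thus ?case using Suc by simp
  qed (simp add: b0)
  hence "inv_qfact (int (m + j)) * (qfact (m + j) * b j) = qfact m * inv_qfact (int (m + j))"
    by (simp add: mult.commute)
  thus ?thesis
    by (simp only: mult.assoc[symmetric] inv_qfact_mult_qfact mult_1_left b_def)
qed

text \<open>With n = N + s, the q-binomial theorem expands (q)_n/(q)_{n+N+c} as a sum over k. After
  interchanging, the sum over s is Euler's and gives (q)_k, which cancels 1/(q)_k.\<close>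

lemma conjugate_bailey:
  "euler_fps * fsum (\<lambda>n. qfact n * inv_qfact (int n - int N) * inv_qfact (int n + int N + int c)) =
   fps_X ^ N * fsum (\<lambda>k. qpoch (fps_X ^ (N + c)) fps_X k * fps_X ^ (N * k))"
proof -
  let ?A = "\<lambda>k. qpoch (fps_X ^ (N + c)) fps_X k :: rat fps"
  have "fsum (\<lambda>n. qfact n * inv_qfact (int n - int N) * inv_qfact (int n + int N + int c)) =
     fps_X ^ N * fsum (\<lambda>s. inv_qfact (int s) * (qfact (N + s) * inv_qfact (int (N + s + (N + c)))))"
    by (subst fsum_drop[of N]) (auto simp: inv_qfact_neg mult_ac add_ac)
  also have "fsum (\<lambda>s. inv_qfact (int s) * (qfact (N + s) * inv_qfact (int (N + s + (N + c))))) =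
     fsum (\<lambda>s. fsum (\<lambda>k. inv_qfact (int s) * (?A k * inv_qfact (int k) * fps_X ^ ((N + s) * k))))"
    by (simp only: q_binomial[symmetric] fsum_mult_left)
  also have "\<dots> = fsum (\<lambda>k. fsum (\<lambda>s. inv_qfact (int s) * (?A k * inv_qfact (int k) * fps_X ^ ((N + s) * k))))"
    by (rule fsum_swap[of "\<lambda>s k. inv_qfact (int s) * (?A k * inv_qfact (int k) * fps_X ^ ((N + s) * k))"])
  also have "(\<lambda>k s. inv_qfact (int s) * (?A k * inv_qfact (int k) * fps_X ^ ((N + s) * k)))
     = (\<lambda>k s. ?A k * fps_X ^ (N * k) * inv_qfact (int k) * (inv_qfact (int s) * fps_X ^ (s * k)))"
    by (intro ext, simp only: distrib_right[of N] power_add[of _ "N * _"]) (simp only: ac_simps)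
  also have "fsum (\<lambda>k. fsum (\<lambda>s. ?A k * fps_X ^ (N * k) * inv_qfact (int k) * (inv_qfact (int s) * fps_X ^ (s * k)))) =
     fsum (\<lambda>k. ?A k * fps_X ^ (N * k) * inv_qfact (int k) * fsum (\<lambda>s. inv_qfact (int s) * fps_X ^ (s * k)))"
    by (simp only: fsum_mult_left)
  finally have "euler_fps * fsum (\<lambda>n. qfact n * inv_qfact (int n - int N) * inv_qfact (int n + int N + int c)) =
    fps_X ^ N * (euler_fps * fsum (\<lambda>k. ?A k * fps_X ^ (N * k) * inv_qfact (int k) * fsum (\<lambda>s. inv_qfact (int s) * fps_X ^ (s * k))))"
    by (simp only: mult.left_commute)
  also have "euler_fps * fsum (\<lambda>k. ?A k * fps_X ^ (N * k) * inv_qfact (int k) * fsum (\<lambda>s. inv_qfact (int s) * fps_X ^ (s * k)))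
     = fsum (\<lambda>k. ?A k * fps_X ^ (N * k) * inv_qfact (int k) * (euler_fps * fsum (\<lambda>s. inv_qfact (int s) * fps_X ^ (s * k))))"
    by (simp only: fsum_mult_left[symmetric] mult.left_commute)
  also have "\<dots> = fsum (\<lambda>k. ?A k * fps_X ^ (N * k))"
    by (simp only: euler_inv_qfact_sum mult.assoc inv_qfact_mult_qfact mult_1_right)
  finally show ?thesis .
qed

text \<open>With x = q^{N+1} this is - sum_k (x)_k x^{k+1}; the sign makes 1 +
  \<open>partial_theta 0\<close> the Euler product.\<close>

definition partial_theta :: "nat \<Rightarrow> rat fps" where
  "partial_theta N = - (fps_X ^ Suc N * fsum (\<lambda>k. qpoch (fps_X ^ Suc N) fps_X k * fps_X ^ (N * k)))"

text \<open>Taking the first factor off (q^N)_k moves the base to q^{N+1}, at the price of the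
  factor 1 - q^N.\<close>

lemma conjugate_bailey_0:
  "euler_fps * fsum (\<lambda>n. qfact n * inv_qfact (int n - int N) * inv_qfact (int n + int N)) =
   fps_X ^ N * (1 - (1 - fps_X ^ N) * partial_theta N)"
proof -
  have "fsum (\<lambda>k. qpoch (fps_X ^ N) fps_X k * fps_X ^ (N * k)) = 1 + fps_X * fsum (\<lambda>k. ((1 - fps_X ^ N) * fps_X ^ N) * (qpoch (fps_X ^ Suc N) fps_X k * fps_X ^ (N * k)))"
    by (subst fsum_shift) (simp add: qpoch_X_Suc_shift power_add mult_ac del: power_Suc)
  also have "\<dots> = 1 - (1 - fps_X ^ N) * partial_theta N"
    unfolding fsum_mult_left partial_theta_def by (simp add: mult_ac)
  finally show ?thesis
    using conjugate_bailey[of N 0] by simp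
qed

text \<open>The extra q avoids the exponent -1; it is why C_1 is later read off at degree
  \<open>Suc k\<close>.\<close>

lemma conjugate_bailey_1:
  "fps_X * (euler_fps * fsum (\<lambda>n. qfact n * inv_qfact (int n - int N) * inv_qfact (int n + int N + 1))) =
   - partial_theta N"
  using conjugate_bailey[of N 1] by (simp add: partial_theta_def mult_ac)

text \<open>Euler's step in the pentagonal number theorem: G(x) = sum_k (x)_k x^k satisfies G(x) = 1
  + x - x^3 q G(xq). The first factor of (x)_k is removed, then the last factor of (xq)_k.\<close>

lemma partial_theta_rec:
  "partial_theta N = - (fps_X ^ Suc N) * (1 + fps_X ^ Suc N + fps_X ^ (2 * Suc N) * partial_theta (Suc N))"
proof -
  define x :: "rat fps" where "x = fps_X ^ Suc N"
  define G where "G = fsum (\<lambda>k. qpoch x fps_X k * fps_X ^ (N * k))"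
  define H where "H = fsum (\<lambda>k. qpoch (x * fps_X) fps_X k * fps_X ^ (N * k))"
  define G' where "G' = fsum (\<lambda>k. qpoch (x * fps_X) fps_X k * fps_X ^ (Suc N * k))"
  have "G = 1 + fps_X * fsum (\<lambda>k. ((1 - x) * fps_X ^ N) * (qpoch (x * fps_X) fps_X k * fps_X ^ (N * k)))"
    unfolding G_def by (subst fsum_shift) (simp add: qpoch_Suc_shift power_add mult_ac)
  hence G: "G = 1 + (1 - x) * x * H"
    unfolding fsum_mult_left H_def by (simp add: x_def mult_ac)
  have "H = 1 + fps_X * fsum (\<lambda>k. fps_X ^ N * (qpoch (x * fps_X) fps_X k * fps_X ^ (N * k)) -
       (x * fps_X * fps_X ^ N) * (qpoch (x * fps_X) fps_X k * fps_X ^ (Suc N * k)))"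
    unfolding H_def by (subst fsum_shift) (simp add: qpoch_Suc power_add algebra_simps)
  hence H: "H = 1 + x * H - x * x * fps_X * G'"
    unfolding fsum_mult_left fsum_diff H_def[symmetric] G'_def[symmetric] by (simp add: x_def algebra_simps)
  \<comment> \<open>The multiple of \<open>H\<close> that occurs in \<open>G\<close>, so nothing has
    to be divided by 1 - x.\<close>
  have "(1 - x) * H = 1 - x * x * fps_X * G'"
    using H by (simp add: algebra_simps)
  hence G_eq: "G = 1 + x * (1 - x * x * fps_X * G')"
    using G by (simp add: mult_ac)
  have pt: "partial_theta N = - (x * G)"
    by (simp add: partial_theta_def G_def x_def)
  have pt': "partial_theta (Suc N) = - (x * fps_X * G')"
    by (simp add: partial_theta_def G'_def x_def mult_ac)
  have x2: "fps_X ^ (2 * Suc N) = x * x"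
    by (simp only: x_def mult_2 power_add)
  show ?thesis
    unfolding x2 x_def[symmetric] pt pt' G_eq by (simp add: algebra_simps)
qed

text \<open>The series telescopes, as q^{k+1} (q)_k = (q)_k - (q)_{k+1}.\<close>

lemma euler_fps_partial_theta: "euler_fps = 1 + partial_theta 0"
proof -
  have tele: "(\<Sum>k<K. fps_X ^ Suc k * qfact k) = 1 - qfact K" for K
    by (induction K) (simp_all add: qfact_Suc algebra_simps)
  have pt: "partial_theta 0 = - (fps_X * fsum qfact)"
    by (simp add: partial_theta_def qfact_def[abs_def])
  have "fps_nth (fps_X * fsum qfact) k = fps_nth (1 - euler_fps) k" for k
  proof -
    have "fps_nth (fps_X * fsum qfact) k = fps_nth (fps_X * (\<Sum>n<k. fps_X ^ n * qfact n)) k"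
      by (cases k) (simp_all add: fsum_nth_finite[of _ k])
    also have "fps_X * (\<Sum>n<k. fps_X ^ n * qfact n) = 1 - qfact k"
      using tele[of k] by (simp add: sum_distrib_left mult.assoc)
    finally show ?thesis by (simp add: euler_fps_nth[of k k])
  qed
  hence "fps_X * fsum qfact = 1 - euler_fps" by (rule fps_ext)
  thus ?thesis by (simp add: pt)
qed

section \<open>Partial theta series\<close>

text \<open>On integers coprime to 6, the only arguments that occur in the sums, this is the
  Kronecker symbol (12/u).\<close>

definition sgn12 :: "int \<Rightarrow> rat" where
  "sgn12 u = (if u mod 12 = 1 \<or> u mod 12 = 11 then 1 else -1)"

text \<open>The series sum over u > b of (12/u) q^{(u^2-1)/24 - d}. Writing pentagonal numbers as
  (u^2 - 1)/24 merges their two families into one. Negative exponents are discarded, hence the lower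
  bounds on u^2 in later assumptions.\<close>

definition theta_tail :: "int \<Rightarrow> int \<Rightarrow> rat fps" where
  "theta_tail b d = Abs_fps (\<lambda>k. \<Sum>u | b < u \<and> u\<^sup>2 = 24 * (int k + d) + 1. sgn12 u)"

lemma theta_tail_nth:
  "fps_nth (theta_tail b d) k = (\<Sum>u | b < u \<and> u\<^sup>2 = 24 * (int k + d) + 1. sgn12 u)"
  by (simp add: theta_tail_def)

lemma abs_le_square_int: "\<bar>u\<bar> \<le> u\<^sup>2" for u :: int
  by (metis abs_ge_zero mult_left_le mult_le_cancel_left1 int_one_le_iff_zero_less linorder_not_le mult_zero_right order.refl order_le_less power2_abs power2_eq_square)

lemma finite_square_eq_int: "finite {u :: int. b < u \<and> u\<^sup>2 = c}"
proof (rule finite_subset)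
  show "{u :: int. b < u \<and> u\<^sup>2 = c} \<subseteq> {-c..c}"
    using abs_le_square_int by (auto simp: abs_le_iff) (metis abs_le_square_int abs_le_iff minus_le_iff)
qed simp

lemma square_mod_24:
  fixes u :: int
  assumes "u\<^sup>2 mod 24 = 1"
  shows "u mod 6 = 1 \<or> u mod 6 = 5"
proof -
  have "(u mod 6)\<^sup>2 mod 6 = (u\<^sup>2 mod 24) mod 6"
    by (simp add: power_mod mod_mod_cancel)
  hence "(u mod 6)\<^sup>2 mod 6 = 1" using assms by simp
  moreover have "u mod 6 \<in> {0, 1, 2, 3, 4, 5}" by auto
  ultimately show ?thesis by auto
qed

text \<open>The assumption ensures that no term of the right-hand side has exponent below e, so none
  is lost on the left.\<close>

lemma theta_tail_shift:
  assumes "\<And>u. b < u \<Longrightarrow> u\<^sup>2 mod 24 = 1 \<Longrightarrow> 24 * (d + int e) + 1 \<le> u\<^sup>2"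
  shows "fps_X ^ e * theta_tail b (d + int e) = theta_tail b d"
proof (rule fps_ext)
  fix k
  show "fps_nth (fps_X ^ e * theta_tail b (d + int e)) k = fps_nth (theta_tail b d) k"
  proof (cases "k < e")
    case True
    have empty: "{u. b < u \<and> u\<^sup>2 = 24 * (int k + d) + 1} = {}"
    proof safe
      fix u assume u: "b < u" "u\<^sup>2 = 24 * (int k + d) + 1"
      have "u\<^sup>2 mod 24 = 1" unfolding u(2) by presburger
      from assms[OF u(1) this] show "u \<in> {}" using u(2) True by simp
    qed
    show ?thesis
      unfolding fps_X_power_mult_nth theta_tail_nth empty using True by simp
  next
    case False
    thus ?thesis
      by (simp add: fps_X_power_mult_nth theta_tail_nth of_nat_diff)
  qed
qed

text \<open>\<open>c\<close> is the first admissible u above \<open>b\<close>; its term, of exponent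
  \<open>n\<close>, is split off.\<close>

lemma theta_tail_extract:
  assumes "b < c" and "c\<^sup>2 = 24 * (int n + d) + 1"
    and "\<And>u. b < u \<Longrightarrow> u < c \<Longrightarrow> u\<^sup>2 mod 24 \<noteq> 1"
  shows "theta_tail b d = fps_const (sgn12 c) * fps_X ^ n + theta_tail c d"
proof (rule fps_ext)
  fix k
  have gap: "u \<ge> c" if "b < u" "u\<^sup>2 = 24 * (int k + d) + 1" for u
  proof -
    have "u\<^sup>2 mod 24 = 1" unfolding that(2) by presburger
    thus ?thesis using assms(3)[of u] that(1) by force
  qed
  have split: "{u. b < u \<and> u\<^sup>2 = 24 * (int k + d) + 1} =
      {u. u = c \<and> k = n} \<union> {u. c < u \<and> u\<^sup>2 = 24 * (int k + d) + 1}"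
  proof (intro Set.set_eqI)
    fix u
    show "u \<in> {u. b < u \<and> u\<^sup>2 = 24 * (int k + d) + 1} \<longleftrightarrow>
      u \<in> {u. u = c \<and> k = n} \<union> {u. c < u \<and> u\<^sup>2 = 24 * (int k + d) + 1}"
      using gap[of u] assms(1,2) by (cases "u = c") auto
  qed
  have "fps_nth (theta_tail b d) k = (\<Sum>u | u = c \<and> k = n. sgn12 u) + fps_nth (theta_tail c d) k"
    unfolding theta_tail_nth split
    by (rule sum.union_disjoint) (auto simp: finite_square_eq_int)
  also have "(\<Sum>u | u = c \<and> k = n. sgn12 u) = fps_nth (fps_const (sgn12 c) * fps_X ^ n) k"
    by auto
  finally show "fps_nth (theta_tail b d) k = fps_nth (fps_const (sgn12 c) * fps_X ^ n + theta_tail c d) k"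
    by simp
qed

lemma sgn12_plus: "sgn12 (6 * int n + 1) = (-1) ^ n"
proof (cases "even n")
  case True
  then obtain m where "n = 2 * m" by blast
  thus ?thesis by (simp add: sgn12_def)
next
  case False
  then obtain m where "n = 2 * m + 1" using oddE by blast
  moreover have "6 * int (2 * m + 1) + 1 = 12 * int m + 7" by simp
  hence "(6 * int (2 * m + 1) + 1) mod 12 = 7" by presburger
  ultimately show ?thesis by (simp add: sgn12_def)
qed

lemma sgn12_minus: "sgn12 (6 * int n + 5) = - ((-1) ^ n)"
proof (cases "even n")
  case True
  then obtain m where "n = 2 * m" by blast
  moreover have "(6 * int (2 * m) + 5) mod 12 = 5" by simp
  ultimately show ?thesis by (simp add: sgn12_def)
next
  case False
  then obtain m where "n = 2 * m + 1" using oddE by blast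
  moreover have "6 * int (2 * m + 1) + 5 = 12 * int m + 11" by simp
  hence "(6 * int (2 * m + 1) + 5) mod 12 = 11" by presburger
  ultimately show ?thesis by (simp add: sgn12_def)
qed

lemma fps_minus_one_power: "(-1) ^ n = fps_const ((-1) ^ n :: rat)"
  by (cases "even n") simp_all

text \<open>One use of the recursion multiplies the difference of two solutions by q^{3(N+1)}, so
  the difference has arbitrarily high order.\<close>

lemma partial_theta_rec_unique:
  fixes f g :: "nat \<Rightarrow> rat fps"
  assumes f: "\<And>N. f N = - (fps_X ^ Suc N) * (1 + fps_X ^ Suc N + fps_X ^ (2 * Suc N) * f (Suc N))"
    and g: "\<And>N. g N = - (fps_X ^ Suc N) * (1 + fps_X ^ Suc N + fps_X ^ (2 * Suc N) * g (Suc N))"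
  shows "f N = g N"
proof -
  have "fps_nth (f N - g N) k = 0" for N k
  proof (induction k arbitrary: N rule: less_induct)
    case (less k)
    have "f N - g N = - (fps_X ^ Suc N * (fps_X ^ (2 * Suc N) * (f (Suc N) - g (Suc N))))"
      by (subst f, subst g) (simp add: algebra_simps)
    also have "\<dots> = - (fps_X ^ (Suc N + 2 * Suc N) * (f (Suc N) - g (Suc N)))"
      by (simp only: power_add mult.assoc)
    finally have "fps_nth (f N - g N) k = - fps_nth (fps_X ^ (Suc N + 2 * Suc N) * (f (Suc N) - g (Suc N))) k"
      by (simp only: fps_neg_nth)
    also have "\<dots> = 0"
      using less.IH[of "k - (Suc N + 2 * Suc N)" "Suc N"] unfolding fps_X_power_mult_nth by auto
    finally show ?case .
  qed
  hence "f N - g N = 0" by (intro fps_ext) simp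
  thus ?thesis by simp
qed

lemma theta_tail_gap:
  fixes u :: int
  assumes "u\<^sup>2 mod 24 = 1"
  shows "6 * j + 1 < u \<Longrightarrow> 6 * j + 5 \<le> u" "6 * j + 5 < u \<Longrightarrow> 6 * j + 7 \<le> u" "6 * j < u \<Longrightarrow> 6 * j + 1 \<le> u"
  using square_mod_24[OF assms] by presburger+

text \<open>The tail obeys the same recursion: u = 6N + 5 and u = 6N + 7 supply the two explicit
  terms, and what remains is the tail for N + 1, with offset larger by 3(N + 1) and opposite
  sign.\<close>

lemma partial_theta_eq_theta_tail:
  "partial_theta N = (-1) ^ N * theta_tail (6 * int N + 1) (3 * int N * (int N + 1) div 2)"
proof -
  define \<theta> where "\<theta> N = (-1) ^ N * theta_tail (6 * int N + 1) (3 * int N * (int N + 1) div 2)" for N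
  have "\<theta> N = - (fps_X ^ Suc N) * (1 + fps_X ^ Suc N + fps_X ^ (2 * Suc N) * \<theta> (Suc N))" for N
  proof -
    define j where "j = int N"
    define d where "d = 3 * j * (j + 1) div 2"
    have "even (3 * j * (j + 1))" by simp
    hence d: "2 * d = 3 * j * (j + 1)" unfolding d_def by simp
    have d': "3 * int (Suc N) * (int (Suc N) + 1) div 2 = d + int (3 * Suc N)"
    proof -
      have "3 * int (Suc N) * (int (Suc N) + 1) = 2 * (d + int (3 * Suc N))"
        using d by (simp add: j_def algebra_simps)
      thus ?thesis by simp
    qed
    have "theta_tail (6 * j + 1) d = fps_const (sgn12 (6 * j + 5)) * fps_X ^ Suc N + theta_tail (6 * j + 5) d"
    proof (rule theta_tail_extract)
      show "(6 * j + 5)\<^sup>2 = 24 * (int (Suc N) + d) + 1"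
        using d by (simp add: j_def power2_eq_square algebra_simps)
      show "u\<^sup>2 mod 24 \<noteq> 1" if "6 * j + 1 < u" "u < 6 * j + 5" for u
        using theta_tail_gap(1)[of u j] that by linarith
    qed simp
    also have "theta_tail (6 * j + 5) d = fps_const (sgn12 (6 * j + 7)) * fps_X ^ (2 * Suc N) + theta_tail (6 * j + 7) d"
    proof (rule theta_tail_extract)
      show "(6 * j + 7)\<^sup>2 = 24 * (int (2 * Suc N) + d) + 1"
        using d by (simp add: j_def power2_eq_square algebra_simps)
      show "u\<^sup>2 mod 24 \<noteq> 1" if "6 * j + 5 < u" "u < 6 * j + 7" for u
        using theta_tail_gap(2)[of u j] that by linarith
    qed simp
    also have "theta_tail (6 * j + 7) d = fps_X ^ (3 * Suc N) * theta_tail (6 * j + 7) (d + int (3 * Suc N))"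
    proof (rule theta_tail_shift[symmetric])
      fix u assume u: "6 * j + 7 < u" "u\<^sup>2 mod 24 = 1"
      \<comment> \<open>The next u coprime to 6 after 6j + 7, by the gap lemma at j + 1.\<close>
      have "6 * j + 11 \<le> u"
        using theta_tail_gap(1)[OF u(2), of "j + 1"] u(1) by simp
      hence "(6 * j + 11)\<^sup>2 \<le> u\<^sup>2"
        by (intro power_mono) (auto simp: j_def)
      thus "24 * (d + int (3 * Suc N)) + 1 \<le> u\<^sup>2"
        using d by (simp add: j_def power2_eq_square algebra_simps)
    qed
    finally have th: "theta_tail (6 * j + 1) d = - ((-1) ^ N) * fps_X ^ Suc N + (- ((-1) ^ N) * fps_X ^ (2 * Suc N) +
       fps_X ^ (3 * Suc N) * theta_tail (6 * j + 7) (d + int (3 * Suc N)))"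
      using sgn12_plus[of "Suc N"] sgn12_minus[of N] unfolding fps_minus_one_power by (simp add: j_def algebra_simps)
    have "2 * Suc N = Suc N + Suc N" "3 * Suc N = Suc N + Suc N + Suc N" by simp_all
    hence pow: "fps_X ^ (2 * Suc N) = (fps_X ^ Suc N * fps_X ^ Suc N :: rat fps)"
      "fps_X ^ (3 * Suc N) = (fps_X ^ Suc N * fps_X ^ Suc N * fps_X ^ Suc N :: rat fps)"
      by (simp_all only: power_add)
    have ring: "s * (- s * x + (- s * (x * x) + x * x * x * t)) = - x * (1 + x + x * x * (- s * t))"
      if "s * s = 1" for s x t :: "rat fps"
    proof -
      have "s * (- s * x + (- s * (x * x) + x * x * x * t)) = - (s * s) * x - (s * s) * (x * x) + x * x * x * (s * t)"
        by (simp add: algebra_simps)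
      thus ?thesis by (simp add: that algebra_simps)
    qed
    have sq: "(-1) ^ N * (-1) ^ N = (1 :: rat fps)"
      by (simp flip: power_mult_distrib)
    have "\<theta> N = - (fps_X ^ Suc N) * (1 + fps_X ^ Suc N + fps_X ^ Suc N * fps_X ^ Suc N *
        (- ((-1) ^ N) * theta_tail (6 * j + 7) (d + int (3 * Suc N))))"
      unfolding \<theta>_def j_def[symmetric] d_def[symmetric] th pow by (rule ring[OF sq])
    moreover have "\<theta> (Suc N) = - ((-1) ^ N) * theta_tail (6 * j + 7) (d + int (3 * Suc N))"
      unfolding \<theta>_def d' by (simp add: j_def algebra_simps)
    ultimately show ?thesis
      unfolding pow by simp
  qed
  from partial_theta_rec_unique[of partial_theta \<theta>, OF partial_theta_rec this] show ?thesis
    by (simp only: \<theta>_def)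
qed

text \<open>Restores the term u = 6N + 1. The two offsets are the values of N(3N+1)/2 at N and -N,
  to serve indices of both signs.\<close>

lemma theta_tail_head:
  "1 + fps_X ^ N * partial_theta N = (-1) ^ N * theta_tail (6 * int N) (int N * (3 * int N + 1) div 2)" (is ?A)
  "fps_X ^ N + fps_X ^ (2 * N) * partial_theta N =
     (-1) ^ N * theta_tail (6 * int N) (int N * (3 * int N - 1) div 2)" (is ?B)
proof -
  define d where "d = 3 * int N * (int N + 1) div 2"
  have d: "2 * d = 3 * int N * (int N + 1)" unfolding d_def by simp
  \<comment> \<open>\<open>i\<close> is the exponent of the term u = 6N + 1: 0 for the first claim,
    \<open>N\<close> for the second.\<close>
  have main: "fps_X ^ i + fps_X ^ (N + i) * partial_theta N = (-1) ^ N * theta_tail (6 * int N) d'"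
    if d': "2 * d' + 2 * int (N + i) = 2 * d" for i d'
  proof -
    have "theta_tail (6 * int N) d' = fps_const (sgn12 (6 * int N + 1)) * fps_X ^ i + theta_tail (6 * int N + 1) d'"
    proof (rule theta_tail_extract)
      show "(6 * int N + 1)\<^sup>2 = 24 * (int i + d') + 1"
        using d d' by (simp add: power2_eq_square algebra_simps)
    qed (auto dest: theta_tail_gap(3))
    also have "theta_tail (6 * int N + 1) d' = fps_X ^ (N + i) * theta_tail (6 * int N + 1) (d' + int (N + i))"
    proof (rule theta_tail_shift[symmetric])
      fix u assume u: "6 * int N + 1 < u" "u\<^sup>2 mod 24 = 1"
      have "6 * int N + 5 \<le> u"
        using theta_tail_gap(1)[OF u(2), of "int N"] u(1) by simp
      hence "(6 * int N + 5)\<^sup>2 \<le> u\<^sup>2"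
        by (intro power_mono) auto
      thus "24 * (d' + int (N + i)) + 1 \<le> u\<^sup>2"
        using d d' by (simp add: power2_eq_square algebra_simps)
    qed
    also have "d' + int (N + i) = d" using d' by simp
    finally have "theta_tail (6 * int N) d' = (-1) ^ N * fps_X ^ i + fps_X ^ (N + i) * theta_tail (6 * int N + 1) d"
      by (simp add: sgn12_plus fps_minus_one_power)
    hence "(-1) ^ N * theta_tail (6 * int N) d' = ((-1) ^ N * (-1) ^ N) * fps_X ^ i + fps_X ^ (N + i) * ((-1) ^ N * theta_tail (6 * int N + 1) d)"
      by (simp only: distrib_left ac_simps)
    also have "(-1) ^ N * (-1) ^ N = (1 :: rat fps)"
      by (simp flip: power_mult_distrib)
    finally show ?thesis
      unfolding partial_theta_eq_theta_tail d_def by simp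
  qed
  have "2 * (int N * (3 * int N + 1) div 2) = int N * (3 * int N + 1)"
       "2 * (int N * (3 * int N - 1) div 2) = int N * (3 * int N - 1)" by simp_all
  hence "2 * (int N * (3 * int N + 1) div 2) + 2 * int (N + 0) = 2 * d"
        "2 * (int N * (3 * int N - 1) div 2) + 2 * int (N + N) = 2 * d"
    unfolding d by (simp_all add: algebra_simps)
  from this[THEN main] show ?A ?B
    by (simp_all only: mult_2 power_0 add_0_right)
qed

section \<open>Schur's identity and the Bailey transform\<close>

definition schur_sign :: "int \<Rightarrow> rat" where
  "schur_sign N = (if N mod 3 = 0 then 1 else if N mod 3 = 1 then -1 else 0)"

text \<open>N(2N+1) is divisible by 3 exactly when N is 0 or 1 modulo 3, the classes of nonzero
  sign.\<close>

definition schur_coeff :: "int \<Rightarrow> rat fps" where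
  "schur_coeff N = fps_const (schur_sign N) * fps_X ^ nat (N * (2 * N + 1) div 3)"

definition schur_term :: "int \<Rightarrow> int \<Rightarrow> int \<Rightarrow> rat fps" where
  "schur_term n c N = schur_coeff N * (inv_qfact (n - N) * inv_qfact (n + N + c))"

text \<open>From 1 - q^{i+j} = (1 - q^j) + q^j (1 - q^i).\<close>

lemma inv_qfact_pascal:
  "(1 - fps_X ^ nat (i + j)) * (inv_qfact i * inv_qfact j) =
   inv_qfact i * inv_qfact (j - 1) + fps_X ^ nat j * (inv_qfact (i - 1) * inv_qfact j)"
proof (cases "i < 0 \<or> j < 0")
  case True
  thus ?thesis by (auto simp: inv_qfact_neg)
next
  case False
  hence "nat (i + j) = nat i + nat j" by (simp add: nat_add_distrib)
  hence "(1 - fps_X ^ nat (i + j)) * (inv_qfact i * inv_qfact j) =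
     inv_qfact i * ((1 - fps_X ^ nat j) * inv_qfact j) +
     fps_X ^ nat j * (((1 - fps_X ^ nat i) * inv_qfact i) * inv_qfact j)"
    by (simp add: power_add algebra_simps)
  thus ?thesis
    using False by (simp add: inv_qfact_step)
qed

lemma sum_antisym:
  fixes t :: "int \<Rightarrow> rat fps"
  assumes "\<And>N. t (a - N) = - t N"
  shows "(\<Sum>N\<in>{l..a - l}. t N) = 0"
proof -
  have "(\<Sum>N\<in>{l..a - l}. t N) = (\<Sum>N\<in>{l..a - l}. t (a - N))"
    by (rule sum.reindex_bij_witness[where i = "\<lambda>N. a - N" and j = "\<lambda>N. a - N"]) auto
  also have "\<dots> = - (\<Sum>N\<in>{l..a - l}. t N)"
    by (simp add: assms sum_negf)
  finally show ?thesis
    by (metis add.inverse_unique add_cancel_right_right eq_neg_iff_add_eq_0 fps_zero_nth mult_2 mult_eq_0_iff zero_neq_numeral)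
qed

lemma schur_coeff_zero: "N mod 3 = 2 \<Longrightarrow> schur_coeff N = 0"
  by (simp add: schur_coeff_def schur_sign_def)

lemma dvd_schur_exponent:
  fixes N :: int
  assumes "N mod 3 \<noteq> 2"
  shows "3 * (N * (2 * N + 1) div 3) = N * (2 * N + 1)"
proof -
  have "N mod 3 = 0 \<or> N mod 3 = 1" using assms by auto
  hence "3 dvd N \<or> 3 dvd 2 * N + 1" by presburger
  hence "3 dvd N * (2 * N + 1)" by auto
  thus ?thesis by simp
qed

lemma schur_exponent_nonneg: "0 \<le> N * (2 * N + 1) div 3" for N :: int
proof -
  have "0 \<le> N * (2 * N + 1)"
    by (cases "N \<ge> 0") (auto intro!: mult_nonpos_nonpos)
  thus ?thesis by simp
qed

text \<open>For \<open>a \<equiv> 1\<close> modulo 3 the involution \<open>N \<mapsto> a - N\<close> swaps the residues 0 and 1 modulo 3, which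
  reverses the sign.\<close>

lemma schur_coeff_reflect:
  assumes "a mod 3 = 1" and "0 \<le> e N" and "0 \<le> e (a - N)"
    and "N * (2 * N + 1) + 3 * e N = (a - N) * (2 * (a - N) + 1) + 3 * e (a - N)"
  shows "schur_coeff (a - N) * fps_X ^ nat (e (a - N)) = - (schur_coeff N * fps_X ^ nat (e N))"
proof (cases "N mod 3 = 2")
  case True
  moreover have "(a - N) mod 3 = 2" using assms(1) True by presburger
  ultimately show ?thesis by (simp add: schur_coeff_zero)
next
  case False
  have N': "(a - N) mod 3 \<noteq> 2" using assms(1) False by presburger
  have sign: "schur_sign (a - N) = - schur_sign N"
  proof -
    have "N mod 3 = 0 \<or> N mod 3 = 1" using False by auto
    thus ?thesis
    proof
      assume *: "N mod 3 = 0"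
      hence "(a - N) mod 3 = 1" using assms(1) by presburger
      with * show ?thesis by (simp add: schur_sign_def)
    next
      assume *: "N mod 3 = 1"
      hence "(a - N) mod 3 = 0" using assms(1) by presburger
      with * show ?thesis by (simp add: schur_sign_def)
    qed
  qed
  have "N * (2 * N + 1) div 3 + e N = (a - N) * (2 * (a - N) + 1) div 3 + e (a - N)"
    using dvd_schur_exponent[OF False] dvd_schur_exponent[OF N'] assms(4) by linarith
  hence "nat (N * (2 * N + 1) div 3) + nat (e N) = nat ((a - N) * (2 * (a - N) + 1) div 3) + nat (e (a - N))"
    using assms(2,3) by (metis nat_add_distrib schur_exponent_nonneg)
  hence "(fps_X :: rat fps) ^ nat (N * (2 * N + 1) div 3) * fps_X ^ nat (e N) =
         fps_X ^ nat ((a - N) * (2 * (a - N) + 1) div 3) * fps_X ^ nat (e (a - N))"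
    by (simp flip: power_add)
  thus ?thesis
    unfolding schur_coeff_def sign mult.assoc by (simp flip: fps_const_neg)
qed

lemma schur_sum_mono:
  assumes "finite I" and "{- (n + c)..n} \<subseteq> I"
  shows "(\<Sum>N\<in>I. schur_term n c N) = (\<Sum>N\<in>{- (n + c)..n}. schur_term n c N)"
  using assms by (intro sum.mono_neutral_right) (auto simp: schur_term_def inv_qfact_neg)

lemma one_minus_fps_X_power_nonzero: "0 < n \<Longrightarrow> 1 - fps_X ^ n \<noteq> (0 :: rat fps)"
proof
  assume "0 < n" "1 - fps_X ^ n = (0 :: rat fps)"
  from arg_cong[OF this(2), of "\<lambda>f. fps_nth f 0"] \<open>0 < n\<close> show False
    by simp
qed

lemma inv_qfact_cancel:
  assumes "0 < m" and "(1 - fps_X ^ nat m) * f = inv_qfact (m - 1)"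
  shows "f = inv_qfact m"
proof -
  have "(1 - fps_X ^ nat m) * f = (1 - fps_X ^ nat m) * inv_qfact m"
    using inv_qfact_step[of m] assms by simp
  thus ?thesis
    using one_minus_fps_X_power_nonzero[of "nat m"] assms(1) by simp
qed

text \<open>The Pascal rule, lowering n + N + 1, produces the sum for c = 0 and a remainder
  \<open>t\<close> that is antisymmetric under N -> -2 - N.\<close>

lemma schur_step_odd:
  assumes "0 \<le> n" and "(\<Sum>N\<in>{- n..n}. schur_term n 0 N) = inv_qfact (2 * n)"
  shows "(\<Sum>N\<in>{- (n + 1)..n}. schur_term n 1 N) = inv_qfact (2 * n + 1)"
proof (rule inv_qfact_cancel)
  \<comment> \<open>The interval from -n - 2 to n: invariant under N -> -2 - N and containing the
    supports of both Schur sums.\<close>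
  define J where "J = {- n - 2.. - 2 - (- n - 2)}"
  define t where "t N = schur_coeff N * fps_X ^ nat (n + N + 1) * (inv_qfact (n - N - 1) * inv_qfact (n + N + 1))" for N
  have "t (- 2 - N) = - t N" for N
  proof (cases "0 \<le> n + N + 1 \<and> 0 \<le> n - N - 1")
    case True
    have eqs: "n - (- 2 - N) - 1 = n + N + 1" "n + (- 2 - N) + 1 = n - N - 1" by simp_all
    have "schur_coeff (- 2 - N) * fps_X ^ nat (n + (- 2 - N) + 1) = - (schur_coeff N * fps_X ^ nat (n + N + 1))"
      by (rule schur_coeff_reflect) (use True in \<open>auto simp: algebra_simps\<close>)
    thus ?thesis
      unfolding t_def eqs by (simp only: mult_minus_left mult_minus_right ac_simps)
  qed (auto simp: t_def inv_qfact_neg)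
  hence t0: "(\<Sum>N\<in>J. t N) = 0"
    unfolding J_def by (rule sum_antisym)
  have step: "(1 - fps_X ^ nat (2 * n + 1)) * schur_term n 1 N = schur_term n 0 N + t N" for N
  proof -
    have "2 * n + 1 = (n - N) + (n + N + 1)" by simp
    hence "(1 - fps_X ^ nat (2 * n + 1)) * schur_term n 1 N =
      schur_coeff N * ((1 - fps_X ^ nat ((n - N) + (n + N + 1))) * (inv_qfact (n - N) * inv_qfact (n + N + 1)))"
      unfolding schur_term_def by (simp only: mult.left_commute)
    thus ?thesis
      unfolding inv_qfact_pascal schur_term_def t_def by (simp add: distrib_left mult.assoc)
  qed
  have "(\<Sum>N\<in>{- (n + 1)..n}. schur_term n 1 N) = (\<Sum>N\<in>J. schur_term n 1 N)"
    by (rule schur_sum_mono[symmetric]) (auto simp: J_def)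
  hence "(1 - fps_X ^ nat (2 * n + 1)) * (\<Sum>N\<in>{- (n + 1)..n}. schur_term n 1 N) = (\<Sum>N\<in>J. schur_term n 0 N)"
    by (simp add: sum_distrib_left step sum.distrib t0)
  also have "\<dots> = (\<Sum>N\<in>{- (n + 0)..n}. schur_term n 0 N)"
    by (rule schur_sum_mono) (auto simp: J_def)
  finally show "(1 - fps_X ^ nat (2 * n + 1)) * (\<Sum>N\<in>{- (n + 1)..n}. schur_term n 1 N) = inv_qfact (2 * n + 1 - 1)"
    using assms(2) by simp
qed (use assms in simp)

text \<open>Here n + 1 - N is lowered, and the remainder is antisymmetric under N -> 1 - N.\<close>

lemma schur_step_even:
  assumes "0 \<le> n" and "(\<Sum>N\<in>{- (n + 1)..n}. schur_term n 1 N) = inv_qfact (2 * n + 1)"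
  shows "(\<Sum>N\<in>{- (n + 1)..n + 1}. schur_term (n + 1) 0 N) = inv_qfact (2 * (n + 1))"
proof (rule inv_qfact_cancel)
  define J where "J = {- n - 1..1 - (- n - 1)}"
  define t where "t N = schur_coeff N * fps_X ^ nat (n + 1 - N) * (inv_qfact (n + 1 - N) * inv_qfact (n + N))" for N
  have "t (1 - N) = - t N" for N
  proof (cases "0 \<le> n + 1 - N \<and> 0 \<le> n + N")
    case True
    have eqs: "n + 1 - (1 - N) = n + N" "n + (1 - N) = n + 1 - N" by simp_all
    have "schur_coeff (1 - N) * fps_X ^ nat (n + 1 - (1 - N)) = - (schur_coeff N * fps_X ^ nat (n + 1 - N))"
      by (rule schur_coeff_reflect) (use True in \<open>auto simp: algebra_simps\<close>)
    thus ?thesis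
      unfolding t_def eqs by (simp only: mult_minus_left mult_minus_right ac_simps)
  qed (auto simp: t_def inv_qfact_neg)
  hence t0: "(\<Sum>N\<in>J. t N) = 0"
    unfolding J_def by (rule sum_antisym)
  have step: "(1 - fps_X ^ nat (2 * (n + 1))) * schur_term (n + 1) 0 N = schur_term n 1 N + t N" for N
  proof -
    have "2 * (n + 1) = (n + N + 1) + (n + 1 - N)" "n + 1 + N + 0 = n + N + 1" by simp_all
    hence "(1 - fps_X ^ nat (2 * (n + 1))) * schur_term (n + 1) 0 N =
      schur_coeff N * ((1 - fps_X ^ nat ((n + N + 1) + (n + 1 - N))) * (inv_qfact (n + N + 1) * inv_qfact (n + 1 - N)))"
      unfolding schur_term_def by (simp only: ac_simps)
    moreover have "n + 1 - N - 1 = n - N" "n + N + 1 - 1 = n + N" by simp_all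
    ultimately show ?thesis
      unfolding inv_qfact_pascal schur_term_def t_def by (simp only: distrib_left ac_simps)
  qed
  have "(\<Sum>N\<in>{- (n + 1)..n + 1}. schur_term (n + 1) 0 N) = (\<Sum>N\<in>{- (n + 1 + 0)..n + 1}. schur_term (n + 1) 0 N)"
    by simp
  also have "\<dots> = (\<Sum>N\<in>J. schur_term (n + 1) 0 N)"
    by (rule schur_sum_mono[symmetric]) (auto simp: J_def)
  finally have "(1 - fps_X ^ nat (2 * (n + 1))) * (\<Sum>N\<in>{- (n + 1)..n + 1}. schur_term (n + 1) 0 N) = (\<Sum>N\<in>J. schur_term n 1 N)"
    by (simp only: sum_distrib_left step sum.distrib t0 add_0_right)
  also have "\<dots> = (\<Sum>N\<in>{- (n + 1)..n}. schur_term n 1 N)"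
    by (rule schur_sum_mono) (auto simp: J_def)
  finally show "(1 - fps_X ^ nat (2 * (n + 1))) * (\<Sum>N\<in>{- (n + 1)..n + 1}. schur_term (n + 1) 0 N) = inv_qfact (2 * (n + 1) - 1)"
    using assms(2) by (simp add: add.commute)
qed (use assms in simp)

lemma schur_identity_even: "(\<Sum>N\<in>{- int n..int n}. schur_term (int n) 0 N) = inv_qfact (2 * int n)"
proof (induction n)
  case 0
  show ?case by (simp add: schur_term_def schur_coeff_def schur_sign_def)
next
  case (Suc n)
  show ?case
    using schur_step_even[OF _ schur_step_odd[OF _ Suc]] by (simp add: add.commute)
qed

lemma schur_identity:
  assumes "c \<le> 1"
  shows "(\<Sum>N\<in>{- (int n + int c)..int n}. schur_term (int n) (int c) N) = inv_qfact (int (n + (n + c)))"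
proof (cases c)
  case 0
  thus ?thesis using schur_identity_even[of n] by simp
next
  case (Suc m)
  hence "c = 1" using assms by simp
  thus ?thesis using schur_step_odd[OF _ schur_identity_even[of n]] by (simp add: add.commute)
qed

section \<open>Bailey transform of the two mock theta functions\<close>

lemma fsum_sum: "finite I \<Longrightarrow> fsum (\<lambda>n. \<Sum>N\<in>I. f N n) = (\<Sum>N\<in>I. fsum (f N))"
  by (induction I rule: finite_induct) (simp_all add: fsum_add, simp add: fsum_def fps_zero_def)

text \<open>The transform is symmetric under N -> -N - c, whereas the conjugate pair is stated for
  natural indices.\<close>

definition fold_index :: "nat \<Rightarrow> int \<Rightarrow> nat" where
  "fold_index c N = nat (if 0 \<le> N then N else - N - int c)"

lemma inv_qfact_fold_index:
  assumes "c \<le> 1"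
  shows "inv_qfact (n - N) * inv_qfact (n + N + int c) =
    inv_qfact (n - int (fold_index c N)) * inv_qfact (n + int (fold_index c N) + int c)"
  using assms by (auto simp: fold_index_def algebra_simps)

text \<open>Degree k only sees n <= k, hence only N from -(k + c) to k. Leaving \<open>I\<close>
  free permits an interval with the symmetry that a later cancellation needs.\<close>

lemma bailey_nth:
  assumes "c \<le> 1" and I: "finite I" "{- (int k + int c)..int k} \<subseteq> I"
  shows "fps_nth (euler_fps * fsum (\<lambda>n. qfact n * inv_qfact (int (n + (n + c))))) k =
    fps_nth (\<Sum>N\<in>I. schur_coeff N * (euler_fps * fsum (\<lambda>n. qfact n * inv_qfact (int n - int (fold_index c N)) *
       inv_qfact (int n + int (fold_index c N) + int c)))) k"
proof -
  let ?g = "\<lambda>N n. qfact n * inv_qfact (int n - int (fold_index c N)) * inv_qfact (int n + int (fold_index c N) + int c)"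
  have g: "qfact n * inv_qfact (int (n + (n + c))) = (\<Sum>N\<in>I. schur_coeff N * ?g N n)" if "n \<le> k" for n
  proof -
    have "(\<Sum>N\<in>I. schur_term (int n) (int c) N) = inv_qfact (int (n + (n + c)))"
      unfolding schur_identity[OF assms(1), symmetric] using I that by (intro schur_sum_mono) auto
    hence "qfact n * inv_qfact (int (n + (n + c))) = (\<Sum>N\<in>I. qfact n * schur_term (int n) (int c) N)"
      by (simp flip: sum_distrib_left)
    moreover have "schur_term (int n) (int c) N = schur_coeff N * (inv_qfact (int n - int (fold_index c N)) *
        inv_qfact (int n + int (fold_index c N) + int c))" for N
      unfolding schur_term_def by (subst inv_qfact_fold_index[OF assms(1)]) (rule refl)
    ultimately show ?thesis by (simp only: ac_simps)
  qed
  have "fps_nth (fsum (\<lambda>n. qfact n * inv_qfact (int (n + (n + c))))) i = fps_nth (fsum (\<lambda>n. \<Sum>N\<in>I. schur_coeff N * ?g N n)) i"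
    if "i \<le> k" for i
    unfolding fsum_nth using that g by (intro sum.cong) simp_all
  hence "fps_nth (fsum (\<lambda>n. qfact n * inv_qfact (int (n + (n + c)))) * euler_fps) k = fps_nth (fsum (\<lambda>n. \<Sum>N\<in>I. schur_coeff N * ?g N n) * euler_fps) k"
    by (rule fps_mult_nth_cong)
  also have "fsum (\<lambda>n. \<Sum>N\<in>I. schur_coeff N * ?g N n) = (\<Sum>N\<in>I. schur_coeff N * fsum (?g N))"
    by (simp only: fsum_sum[OF I(1)] fsum_mult_left)
  finally show ?thesis
    by (simp only: sum_distrib_left sum_distrib_right ac_simps)
qed

lemma C1_eq_partial_theta:
  assumes "finite I" "{- (int k + 1)..int k} \<subseteq> I"
  shows "C1 k = - (\<Sum>N\<in>I. fps_nth (schur_coeff N * partial_theta (fold_index 1 N)) (Suc k))"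
proof -
  have "C1 k = fps_nth (fps_X * (\<Sum>N\<in>I. schur_coeff N * (euler_fps * fsum (\<lambda>n. qfact n * inv_qfact (int n - int (fold_index 1 N)) *
       inv_qfact (int n + int (fold_index 1 N) + 1))))) (Suc k)"
    unfolding C1_def chi1_fsum using bailey_nth[of 1 I k] assms by simp
  also have "fps_X * (\<Sum>N\<in>I. schur_coeff N * (euler_fps * fsum (\<lambda>n. qfact n * inv_qfact (int n - int (fold_index 1 N)) *
       inv_qfact (int n + int (fold_index 1 N) + 1)))) = (\<Sum>N\<in>I. schur_coeff N * - partial_theta (fold_index 1 N))"
    unfolding conjugate_bailey_1[symmetric] by (simp only: sum_distrib_left mult.left_commute[of fps_X])
  finally show ?thesis
    by (simp add: fps_sum_nth sum_negf)
qed

text \<open>For either sign of N this is, up to sign, a_N times the theta series over u > 6|N| with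
  offset N(3N+1)/2.\<close>

definition hecke0 :: "int \<Rightarrow> rat fps" where
  "hecke0 N = (if 0 \<le> N then schur_coeff N * (1 + fps_X ^ nat N * partial_theta (nat N))
     else - (schur_coeff N * (fps_X ^ nat (- N) + fps_X ^ (2 * nat (- N)) * partial_theta (nat (- N)))))"

text \<open>The discrepancy \<open>\<Delta> N\<close> is \<open>R (1 - N)\<close> for N >= 1 and
  \<open>- R N\<close> for N <= 0, with 2 (q)_inf added at N = 0. Summed over pairs N, 1 - N,
  everything but 2 (q)_inf cancels.\<close>

lemma C0_eq_hecke0:
  assumes "k \<le> K"
  shows "C0 k = (\<Sum>N\<in>{- int K..int K + 1}. fps_nth (hecke0 N) k)"
proof -
  \<comment> \<open>The end points differ by one in size so that N -> 1 - N preserves the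
    interval.\<close>
  define I where "I = {- int K..1 - (- int K)}"
  define B where "B N = schur_coeff N * (fps_X ^ nat \<bar>N\<bar> * (1 - (1 - fps_X ^ nat \<bar>N\<bar>) * partial_theta (nat \<bar>N\<bar>)))" for N
  define \<Delta> where "\<Delta> N = hecke0 N + B N" for N
  have "fold_index 0 N = nat \<bar>N\<bar>" for N by (simp add: fold_index_def)
  moreover have "euler_fps * fsum (\<lambda>n. qfact n * inv_qfact (int n - \<bar>N\<bar>) * inv_qfact (int n + \<bar>N\<bar>)) =
    fps_X ^ nat \<bar>N\<bar> * (1 - (1 - fps_X ^ nat \<bar>N\<bar>) * partial_theta (nat \<bar>N\<bar>))" for N
    using conjugate_bailey_0[of "nat \<bar>N\<bar>"] by simp
  ultimately have chi: "fps_nth (euler_fps * chi0) k = fps_nth (\<Sum>N\<in>I. B N) k"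
    unfolding chi0_fsum B_def using bailey_nth[of 0 I k] assms
    by (simp add: I_def)
  define R where "R N = schur_coeff N * (fps_X ^ nat (- N) * partial_theta (nat (- N)))" for N
  have pos: "\<Delta> N = R (1 - N)" if "1 \<le> N" for N
  proof -
    define n where "n = nat (N - 1)"
    have n: "nat N = Suc n" "nat (- (1 - N)) = n" using that by (simp_all add: n_def)
    \<comment> \<open>Reflection with the whole power on one side: a_N = - q^{2N-1} a_{1-N}.\<close>
    have "schur_coeff (1 - N) * fps_X ^ nat (2 * N - 1) = - (schur_coeff N * fps_X ^ nat 0)"
      using schur_coeff_reflect[of 1 "\<lambda>M. if M = N then 0 else 2 * N - 1" N] that
      by (simp add: algebra_simps split: if_splits)
    moreover have "nat (2 * N - 1) = n + Suc n" using that by (simp add: n_def)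
    ultimately have refl: "schur_coeff N = - (schur_coeff (1 - N) * (fps_X ^ n * fps_X ^ Suc n))"
      by (simp only: power_add) simp
    have ring: "s * (1 + x * t) + s * (x * (1 - (1 - x) * t)) = s * (1 + x + x * x * t)" for s x t :: "rat fps"
      by (simp add: algebra_simps)
    have "\<Delta> N = schur_coeff N * (1 + fps_X ^ Suc n + fps_X ^ Suc n * fps_X ^ Suc n * partial_theta (Suc n))"
      unfolding \<Delta>_def hecke0_def B_def using that n(1) by (simp add: ring del: power_Suc)
    also have "\<dots> = schur_coeff (1 - N) * (fps_X ^ n * (- (fps_X ^ Suc n) * (1 + fps_X ^ Suc n + fps_X ^ (2 * Suc n) * partial_theta (Suc n))))"
      unfolding refl mult_2 power_add by (simp only: mult_minus_left mult_minus_right mult.assoc)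
    also have "\<dots> = R (1 - N)"
      unfolding R_def n partial_theta_rec[symmetric] ..
    finally show ?thesis .
  qed
  \<comment> \<open>At N = 0 the discrepancy is (q)_inf + 1 while \<open>R 0\<close> is (q)_inf -
    1.\<close>
  have neg: "\<Delta> N = (if N = 0 then 2 * euler_fps else 0) - R N" if "N \<le> 0" for N
  proof (cases "N = 0")
    case True
    thus ?thesis
      by (simp add: \<Delta>_def hecke0_def B_def R_def euler_fps_partial_theta schur_coeff_def schur_sign_def)
  next
    case False
    have ring: "s * (x * (1 - (1 - x) * t)) - s * (x + x * x * t) = - (s * (x * t))" for s x t :: "rat fps"
      by (simp add: algebra_simps)
    show ?thesis
      using that False unfolding \<Delta>_def hecke0_def B_def R_def mult_2 power_add by (simp add: ring)
  qed
  have "(\<Sum>N\<in>I. \<Delta> N) = (\<Sum>N\<in>{- int K..0}. \<Delta> N) + (\<Sum>N\<in>{1..int K + 1}. \<Delta> N)"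
    unfolding I_def by (subst sum.union_disjoint[symmetric]) (auto intro!: sum.cong)
  also have "(\<Sum>N\<in>{1..int K + 1}. \<Delta> N) = (\<Sum>N\<in>{- int K..0}. R N)"
    by (rule sum.reindex_bij_witness[where i = "\<lambda>N. 1 - N" and j = "\<lambda>N. 1 - N"]) (auto simp: pos)
  also have "(\<Sum>N\<in>{- int K..0}. \<Delta> N) = (\<Sum>N\<in>{- int K..0}. if N = 0 then 2 * euler_fps else 0) - (\<Sum>N\<in>{- int K..0}. R N)"
    unfolding sum_subtractf[symmetric] by (intro sum.cong) (auto simp: neg)
  also have "(\<Sum>N\<in>{- int K..0}. if N = 0 then 2 * euler_fps else 0) = 2 * euler_fps"
    by simp
  finally have "(\<Sum>N\<in>I. hecke0 N) = 2 * euler_fps - (\<Sum>N\<in>I. B N)"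
    by (simp add: \<Delta>_def sum.distrib algebra_simps)
  hence "fps_nth (\<Sum>N\<in>I. hecke0 N) k = fps_nth (euler_fps * (2 - chi0)) k"
    using chi by (simp add: right_diff_distrib mult.commute)
  thus ?thesis
    by (simp add: C0_def I_def fps_sum_nth add.commute)
qed

section \<open>Hecke sums\<close>

text \<open>The Legendre symbol (y/5) times a half-period sign. On the values y = |v| it packs
  together the sign of N, the Schur sign and the parity of N. It is odd under y -> -y, and not
  multiplicative.\<close>

definition sgn60 :: "int \<Rightarrow> rat" where
  "sgn60 y = (if y mod 5 = 1 \<or> y mod 5 = 4 then 1 else -1) * (if y mod 60 < 30 then 1 else -1)"

text \<open>\<open>y\<close> stands for |v|; \<open>odd u\<close> reflects that v = 10N + 1 or 10N +
  7 is odd, since u and v have equal parity.\<close>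

definition norm_reps :: "int \<Rightarrow> (int \<times> int) set" where
  "norm_reps m = {(u, y). 0 < u \<and> 0 < y \<and> 3 * y < 5 * u \<and> odd u \<and> 5 * u\<^sup>2 = y\<^sup>2 + 4 * m}"

definition hecke_sum :: "int \<Rightarrow> rat" where
  "hecke_sum m = (\<Sum>(u, y)\<in>norm_reps m. sgn12 u * sgn60 y)"

text \<open>The cone turns an indefinite equation into a finite one: 9 y^2 <= 25 u^2 = 5 y^2 + 20
  m.\<close>

lemma norm_reps_bound:
  assumes "(u, y) \<in> norm_reps m"
  shows "y \<le> 5 * m"
proof -
  from assms have *: "0 < u" "0 < y" "3 * y < 5 * u" "5 * u\<^sup>2 = y\<^sup>2 + 4 * m"
    by (auto simp: norm_reps_def)
  have "(3 * y)\<^sup>2 \<le> (5 * u)\<^sup>2"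
    using * by (intro power_mono) auto
  hence "9 * y\<^sup>2 \<le> 25 * u\<^sup>2" by (simp add: power_mult_distrib)
  hence "y\<^sup>2 \<le> 5 * m" using *(4) by linarith
  thus ?thesis
    using abs_le_square_int[of y] by linarith
qed

lemma fps_nth_minus_one_power_mult: "fps_nth ((-1) ^ n * f) k = (-1) ^ n * fps_nth (f :: rat fps) k"
  by (simp add: fps_minus_one_power)

lemma schur_coeff_mult_theta_tail:
  assumes "N mod 3 \<noteq> 2" and "\<And>u. b < u \<Longrightarrow> u\<^sup>2 mod 24 = 1 \<Longrightarrow> 24 * d + 1 \<le> u\<^sup>2"
    and "3 * d = 3 * d' + N * (2 * N + 1)"
  shows "schur_coeff N * theta_tail b d = fps_const (schur_sign N) * theta_tail b d'"
proof -
  have d: "d = d' + int (nat (N * (2 * N + 1) div 3))"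
    using dvd_schur_exponent[OF assms(1)] schur_exponent_nonneg[of N] assms(3) by simp
  have "fps_X ^ nat (N * (2 * N + 1) div 3) * theta_tail b d = theta_tail b d'"
    unfolding d using assms(2) by (intro theta_tail_shift) (simp add: d)
  thus ?thesis
    by (simp add: schur_coeff_def mult.assoc)
qed

lemma schur_coeff_partial_theta_nth:
  assumes "N mod 3 \<noteq> 2"
  shows "fps_nth (schur_coeff N * partial_theta (fold_index 1 N)) (Suc k) =
    schur_sign N * (-1) ^ fold_index 1 N *
      (\<Sum>u | 6 * int (fold_index 1 N) + 1 < u \<and> 5 * u\<^sup>2 = (10 * N + 7)\<^sup>2 + 4 * (30 * int k + 19). sgn12 u)"
proof -
  define n where "n = int (fold_index 1 N)"
  define d where "d = 3 * n * (n + 1) div 2"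
  define d' where "d' = d - N * (2 * N + 1) div 3"
  have d: "2 * d = 3 * n * (n + 1)" unfolding d_def by simp
  have n: "n \<ge> 0" "n = N \<or> n = - N - 1" by (auto simp: n_def fold_index_def)
  have nN: "n * (n + 1) = N * (N + 1)" using n(2) by (elim disjE, simp, simp only:, simp add: algebra_simps)
  have e: "3 * (d - d') = N * (2 * N + 1)"
    unfolding d'_def using dvd_schur_exponent[OF assms] by simp
  have th: "schur_coeff N * theta_tail (6 * n + 1) d = fps_const (schur_sign N) * theta_tail (6 * n + 1) d'"
  proof (rule schur_coeff_mult_theta_tail[OF assms])
    fix u assume u: "6 * n + 1 < u" "u\<^sup>2 mod 24 = 1"
    have "6 * n + 5 \<le> u"
      using theta_tail_gap(1)[OF u(2) u(1)] by simp
    hence "(6 * n + 5)\<^sup>2 \<le> u\<^sup>2"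
      using n by (intro power_mono) auto
    thus "24 * d + 1 \<le> u\<^sup>2"
      using d n by (simp add: power2_eq_square algebra_simps)
  qed (use e in simp)
  have eq: "u\<^sup>2 = 24 * (int (Suc k) + d') + 1 \<longleftrightarrow> 5 * u\<^sup>2 = (10 * N + 7)\<^sup>2 + 4 * (30 * int k + 19)" for u
  proof -
    have "6 * d' = 9 * (N * (N + 1)) - 2 * (N * (2 * N + 1))"
      using d e nN by (simp add: algebra_simps)
    \<comment> \<open>Five times u^2 - 1 = 24 (k + 1 + d') then reads 5u^2 = v^2 - 44 + 120 (k + 1)
      with v = 10N + 7, and 120 - 44 = 4 * 19.\<close>
    hence "120 * d' = (10 * N + 7)\<^sup>2 - 49"
      by (simp add: power2_eq_square algebra_simps)
    thus ?thesis by auto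
  qed
  show ?thesis
    unfolding partial_theta_eq_theta_tail mult.left_commute[of "schur_coeff N"] n_def[symmetric] d_def[symmetric] th
      fps_nth_minus_one_power_mult fps_mult_left_const_nth theta_tail_nth eq
    by (simp only: ac_simps)
qed

definition sgn_int :: "int \<Rightarrow> rat" where
  "sgn_int N = (if 0 \<le> N then 1 else -1)"

lemma hecke0_nth:
  assumes "N mod 3 \<noteq> 2"
  shows "fps_nth (hecke0 N) k =
    sgn_int N * schur_sign N * (-1) ^ nat \<bar>N\<bar> *
      (\<Sum>u | 6 * \<bar>N\<bar> < u \<and> 5 * u\<^sup>2 = (10 * N + 1)\<^sup>2 + 4 * (30 * int k + 1). sgn12 u)"
proof -
  define d where "d = N * (3 * N + 1) div 2"
  define d' where "d' = d - N * (2 * N + 1) div 3"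
  have d: "2 * d = N * (3 * N + 1)" unfolding d_def by simp
  have e: "3 * (d - d') = N * (2 * N + 1)"
    unfolding d'_def using dvd_schur_exponent[OF assms] by simp
  have th: "schur_coeff N * theta_tail (6 * \<bar>N\<bar>) d = fps_const (schur_sign N) * theta_tail (6 * \<bar>N\<bar>) d'"
  proof (rule schur_coeff_mult_theta_tail[OF assms])
    fix u assume u: "6 * \<bar>N\<bar> < u" "u\<^sup>2 mod 24 = 1"
    have "(6 * \<bar>N\<bar> + 1)\<^sup>2 \<le> u\<^sup>2"
      using u by (intro power_mono) auto
    moreover have "24 * d \<le> 36 * N\<^sup>2 + 12 * \<bar>N\<bar>"
      using d by (simp add: power2_eq_square algebra_simps)
    ultimately show "24 * d + 1 \<le> u\<^sup>2"
      by (simp add: power2_eq_square algebra_simps)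
  qed (use e in simp)
  have eq: "u\<^sup>2 = 24 * (int k + d') + 1 \<longleftrightarrow> 5 * u\<^sup>2 = (10 * N + 1)\<^sup>2 + 4 * (30 * int k + 1)" for u
  proof -
    have "6 * d' = 3 * (N * (3 * N + 1)) - 2 * (N * (2 * N + 1))"
      using d e by (simp add: algebra_simps)
    hence "120 * d' = (10 * N + 1)\<^sup>2 - 1"
      by (simp add: power2_eq_square algebra_simps)
    thus ?thesis by auto
  qed
  have h: "hecke0 N = fps_const (sgn_int N) * (schur_coeff N * ((-1) ^ nat \<bar>N\<bar> * theta_tail (6 * \<bar>N\<bar>) d))"
  proof (cases "0 \<le> N")
    case True
    thus ?thesis
      using theta_tail_head(1)[of "nat N"] by (simp add: hecke0_def sgn_int_def d_def)
  next
    case False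
    have "- N * (3 * - N - 1) = N * (3 * N + 1)" by (simp add: algebra_simps)
    thus ?thesis
      using False theta_tail_head(2)[of "nat (- N)"] by (simp add: hecke0_def sgn_int_def d_def flip: fps_const_neg)
  qed
  show ?thesis
    unfolding h mult.left_commute[of "schur_coeff N"] th
      fps_nth_minus_one_power_mult fps_mult_left_const_nth theta_tail_nth eq
    by (simp only: ac_simps)
qed

section \<open>Residues and signs on solutions of the norm equation\<close>

lemma mod_square: "(x\<^sup>2) mod n = ((x mod n)\<^sup>2) mod n" for x n :: int
  by (simp add: power_mod)

lemma square_mod_3: "x\<^sup>2 mod 3 = (if x mod 3 = 0 then 0 else 1)" for x :: int
proof -
  have "x mod 3 \<in> {0, 1, 2}" by auto
  thus ?thesis by (auto simp: mod_square[of x 3])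
qed

lemma square_mod_5:
  "x\<^sup>2 mod 5 = (if x mod 5 = 0 then 0 else if x mod 5 = 1 \<or> x mod 5 = 4 then 1 else 4)" for x :: int
proof -
  have "x mod 5 \<in> {0, 1, 2, 3, 4}" by auto
  thus ?thesis by (auto simp: mod_square[of x 5])
qed

text \<open>Modulo 3 the equation is 2u^2 = y^2 + 1 with squares 0 or 1, which forces both squares
  to be 1.\<close>

lemma norm_form_coprime:
  fixes u y m :: int
  assumes "5 * u\<^sup>2 = y\<^sup>2 + 4 * m" and "m mod 3 = 1"
  shows "y mod 3 \<noteq> 0" "u mod 3 \<noteq> 0" "odd u \<longleftrightarrow> odd y"
proof -
  have sq: "u\<^sup>2 mod 3 = 0 \<or> u\<^sup>2 mod 3 = 1" "y\<^sup>2 mod 3 = 0 \<or> y\<^sup>2 mod 3 = 1"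
    by (simp_all add: square_mod_3)
  have mod: "(5 * (u\<^sup>2 mod 3)) mod 3 = (y\<^sup>2 mod 3 + (4 * (m mod 3)) mod 3) mod 3"
    by (simp only: mod_simps assms(1))
  have "i = 1 \<and> j = 1"
    if "i = 0 \<or> i = 1" "j = 0 \<or> j = 1" "(5 * i) mod 3 = (j + (4 * 1) mod 3) mod 3" for i j :: int
    using that by (elim disjE; hypsubst; simp)
  from this[OF sq mod[unfolded assms(2)]] show "y mod 3 \<noteq> 0" "u mod 3 \<noteq> 0"
    by (simp_all add: square_mod_3 split: if_splits)
  have "even (5 * u\<^sup>2) \<longleftrightarrow> even (y\<^sup>2 + 4 * m)" using assms by simp
  thus "odd u \<longleftrightarrow> odd y" by simp
qed

lemma norm_form_mod_5:
  fixes u y m :: int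
  assumes "5 * u\<^sup>2 = y\<^sup>2 + 4 * m"
  shows "m mod 5 = 1 \<Longrightarrow> y mod 5 = 1 \<or> y mod 5 = 4" "m mod 5 = 4 \<Longrightarrow> y mod 5 = 2 \<or> y mod 5 = 3"
proof -
  have "y\<^sup>2 = m + 5 * (u\<^sup>2 - m)" using assms by simp
  hence 1: "y\<^sup>2 mod 5 = m mod 5" by (simp only: mod_mult_self2)
  have 2: "y mod 5 \<in> {0, 1, 2, 3, 4}" by auto
  show "m mod 5 = 1 \<Longrightarrow> y mod 5 = 1 \<or> y mod 5 = 4" "m mod 5 = 4 \<Longrightarrow> y mod 5 = 2 \<or> y mod 5 = 3"
    using 1 2 by (auto simp: square_mod_5)
qed

lemma odd_mod_10:
  fixes y :: int
  assumes "odd y"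
  shows "y mod 5 = 1 \<or> y mod 5 = 4 \<Longrightarrow> y mod 10 = 1 \<or> (- y) mod 10 = 1"
    and "y mod 5 = 2 \<or> y mod 5 = 3 \<Longrightarrow> y mod 10 = 7 \<or> (- y) mod 10 = 7"
proof -
  have table: "\<forall>i\<in>set [0..9::int]. i mod 2 = 1 \<longrightarrow> i \<noteq> 0 \<and>
      ((i mod 5 = 1 \<or> i mod 5 = 4) \<longrightarrow> i = 1 \<or> 10 - i = 1) \<and>
      ((i mod 5 = 2 \<or> i mod 5 = 3) \<longrightarrow> i = 7 \<or> 10 - i = 7)"
    by code_simp
  have mods: "y mod 10 mod 2 = y mod 2" "y mod 10 mod 5 = y mod 5"
    by (rule mod_mod_cancel, simp)+
  have mem: "y mod 10 \<in> set [0..9]" by simp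
  have one: "y mod 10 mod 2 = 1"
    unfolding mods using assms by (rule odd_iff_mod_2_eq_one[THEN iffD1])
  note tab = table[THEN bspec, OF mem, THEN mp, OF one, unfolded mods]
  have neg: "(- y) mod 10 = 10 - y mod 10"
    using tab[THEN conjunct1] by (simp only: zmod_zminus1_eq_if if_False)
  show "y mod 5 = 1 \<or> y mod 5 = 4 \<Longrightarrow> y mod 10 = 1 \<or> (- y) mod 10 = 1"
    unfolding neg by (rule tab[THEN conjunct2, THEN conjunct1, THEN mp])
  show "y mod 5 = 2 \<or> y mod 5 = 3 \<Longrightarrow> y mod 10 = 7 \<or> (- y) mod 10 = 7"
    unfolding neg by (rule tab[THEN conjunct2, THEN conjunct2, THEN mp])
qed

lemma mod_60_imp_mod_5:
  fixes a b :: int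
  assumes "a mod 60 = b mod 60"
  shows "a mod 5 = b mod 5"
proof -
  have "x mod 60 mod 5 = x mod 5" for x :: int by (rule mod_mod_cancel) simp
  thus ?thesis using assms by metis
qed

lemma mod_6_cases:
  fixes N :: int
  assumes "N mod 3 \<noteq> 2"
  obtains q r where "N = 6 * q + r" "r \<in> {0, 1, 3, 4}"
proof
  show "N = 6 * (N div 6) + N mod 6" by simp
  have "N mod 6 \<in> {0, 1, 2, 3, 4, 5}" by auto
  moreover have "N mod 6 mod 3 = N mod 3" by (simp add: mod_mod_cancel)
  ultimately show "N mod 6 \<in> {0, 1, 3, 4}" using assms by auto
qed

text \<open>N -> N + 6 shifts v by 60 and preserves the parity of N and the Schur sign, which leaves
  four residues to check. A negative N amounts to y -> -y, matched by
  \<open>sgn_int\<close>.\<close>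

lemma sgn60_class_1:
  assumes "N mod 3 \<noteq> 2"
  shows "sgn60 \<bar>10 * N + 1\<bar> = sgn_int N * schur_sign N * (-1) ^ nat \<bar>N\<bar>"
proof -
  obtain q r where N: "N = 6 * q + r" and r: "r \<in> {0, 1, 3, 4}" using mod_6_cases[OF assms] .
  have par: "(-1) ^ nat \<bar>N\<bar> = (if even r then 1 else -1 :: rat)"
    by (simp add: minus_one_power_iff even_nat_iff N)
  have sch: "schur_sign N = (if r mod 3 = 0 then 1 else -1)"
  proof -
    have "N mod 3 = r mod 3" using N by presburger
    thus ?thesis using r by (auto simp: schur_sign_def)
  qed
  show ?thesis
  proof (cases "0 \<le> N")
    case True
    have "\<bar>10 * N + 1\<bar> = (10 * r + 1) + 60 * q" using True by (simp add: N)
    hence v: "\<bar>10 * N + 1\<bar> mod 60 = (10 * r + 1) mod 60"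
      by (simp only: mod_mult_self2)
    note v = v mod_60_imp_mod_5[OF v]
    show ?thesis unfolding sgn60_def v par sch sgn_int_def using r True by auto
  next
    case False
    have "\<bar>10 * N + 1\<bar> = (- 10 * r - 1) + 60 * (- q)" using False by (simp add: N)
    hence v: "\<bar>10 * N + 1\<bar> mod 60 = (- 10 * r - 1) mod 60"
      by (simp only: mod_mult_self2)
    note v = v mod_60_imp_mod_5[OF v]
    show ?thesis unfolding sgn60_def v par sch sgn_int_def using r False by auto
  qed
qed

text \<open>For N < 0 the folded index -N - 1 has the parity opposite to N; this replaces the factor
  \<open>sgn_int\<close>.\<close>

lemma sgn60_class_7:
  assumes "N mod 3 \<noteq> 2"
  shows "sgn60 \<bar>10 * N + 7\<bar> = - (schur_sign N * (-1) ^ fold_index 1 N)"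
proof -
  obtain q r where N: "N = 6 * q + r" and r: "r \<in> {0, 1, 3, 4}" using mod_6_cases[OF assms] .
  have par: "(-1) ^ fold_index 1 N = (if even r = (0 \<le> N) then 1 else -1 :: rat)"
    by (simp add: minus_one_power_iff even_nat_iff fold_index_def) (simp add: N)
  have sch: "schur_sign N = (if r mod 3 = 0 then 1 else -1)"
  proof -
    have "N mod 3 = r mod 3" using N by presburger
    thus ?thesis using r by (auto simp: schur_sign_def)
  qed
  show ?thesis
  proof (cases "0 \<le> N")
    case True
    have "\<bar>10 * N + 7\<bar> = (10 * r + 7) + 60 * q" using True by (simp add: N)
    hence v: "\<bar>10 * N + 7\<bar> mod 60 = (10 * r + 7) mod 60"
      by (simp only: mod_mult_self2)
    note v = v mod_60_imp_mod_5[OF v]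
    show ?thesis unfolding sgn60_def v par sch using r True by auto
  next
    case False
    have "\<bar>10 * N + 7\<bar> = (- 10 * r - 7) + 60 * (- q)" using False by (simp add: N)
    hence v: "\<bar>10 * N + 7\<bar> mod 60 = (- 10 * r - 7) mod 60"
      by (simp only: mod_mult_self2)
    note v = v mod_60_imp_mod_5[OF v]
    show ?thesis unfolding sgn60_def v par sch using r False by auto
  qed
qed

text \<open>Serves both t = 1 and t = 7. Exactly one of y and -y is t modulo 10, so y = |10N + t|
  determines N; N mod 3 = 2 would make 10N + t a multiple of 3. The range \<open>b N < u\<close> of
  the theta series agrees with the cone only on u coprime to 6.\<close>

lemma hecke_sum_regroup:
  fixes m t :: int and s :: "int \<Rightarrow> rat" and b :: "int \<Rightarrow> int"
  assumes m: "m mod 3 = 1" and t: "t mod 2 = 1" "t mod 3 = 1" "0 \<le> t" "t < 10"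
    and y_mod: "\<And>u y. 5 * u\<^sup>2 = y\<^sup>2 + 4 * m \<Longrightarrow> odd y \<Longrightarrow> y mod 10 = t \<or> (- y) mod 10 = t"
    and b: "\<And>N u. N mod 3 \<noteq> 2 \<Longrightarrow> odd u \<Longrightarrow> u mod 3 \<noteq> 0 \<Longrightarrow> b N < u \<longleftrightarrow> 0 < u \<and> 3 * \<bar>10 * N + t\<bar> < 5 * u"
    and s: "\<And>N. N mod 3 \<noteq> 2 \<Longrightarrow> s N = sgn60 \<bar>10 * N + t\<bar>"
    and K: "\<And>N. \<bar>10 * N + t\<bar> \<le> 5 * m \<Longrightarrow> \<bar>N\<bar> \<le> K"
    and t2: "t \<noteq> (- t) mod 10"
  shows "(\<Sum>N | N \<in> {- K..K + 1} \<and> N mod 3 \<noteq> 2. s N * (\<Sum>u | b N < u \<and> 5 * u\<^sup>2 = (10 * N + t)\<^sup>2 + 4 * m. sgn12 u)) = hecke_sum m"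
proof -
  let ?I = "{N. N \<in> {- K..K + 1} \<and> N mod 3 \<noteq> 2}"
  let ?U = "\<lambda>N. {u. b N < u \<and> 5 * u\<^sup>2 = (10 * N + t)\<^sup>2 + 4 * m}"
  have fin: "finite (?U N)" for N
  proof (rule finite_subset)
    show "?U N \<subseteq> {u. b N < u \<and> u\<^sup>2 = ((10 * N + t)\<^sup>2 + 4 * m) div 5}"
    proof safe
      fix u assume "5 * u\<^sup>2 = (10 * N + t)\<^sup>2 + 4 * m"
      thus "u\<^sup>2 = ((10 * N + t)\<^sup>2 + 4 * m) div 5"
        by (metis nonzero_mult_div_cancel_left zero_neq_numeral)
    qed
  qed (rule finite_square_eq_int)
  have finI: "finite ?I" by (rule finite_subset[of _ "{- K..K + 1}"]) auto
  have rep: "odd u \<and> u mod 3 \<noteq> 0" if "5 * u\<^sup>2 = (10 * N + t)\<^sup>2 + 4 * m" for N u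
  proof -
    have "odd (10 * N + t)" using t(1) by presburger
    thus ?thesis using norm_form_coprime[OF that m] by simp
  qed
  have "(\<Sum>N\<in>?I. s N * sum sgn12 (?U N)) = (\<Sum>(N, u)\<in>(SIGMA N:?I. ?U N). s N * sgn12 u)"
    unfolding sum_distrib_left by (rule sum.Sigma) (use fin finI in auto)
  also have "\<dots> = (\<Sum>(u, y)\<in>norm_reps m. sgn12 u * sgn60 y)"
  proof (rule sum.reindex_bij_witness[where
        i = "\<lambda>(u, y). (if y mod 10 = t then y div 10 else (- y) div 10, u)" and
        j = "\<lambda>(N, u). (u, \<bar>10 * N + t\<bar>)"])
    fix x assume x: "x \<in> (SIGMA N:?I. ?U N)"
    obtain N u where xe: "x = (N, u)" by (cases x)
    have N: "N mod 3 \<noteq> 2" and u: "b N < u" "5 * u\<^sup>2 = (10 * N + t)\<^sup>2 + 4 * m"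
      using x by (auto simp: xe)
    have v: "(10 * N + t) mod 10 = t" "(10 * N + t) div 10 = N" using t(3,4) by auto
    have "- (10 * N + t) = - t + 10 * (- N)" by simp
    hence v': "(- (10 * N + t)) mod 10 = (- t) mod 10" by (simp only: mod_mult_self2)
    show "(case case x of (N, u) \<Rightarrow> (u, \<bar>10 * N + t\<bar>) of (u, y) \<Rightarrow> (if y mod 10 = t then y div 10 else (- y) div 10, u)) = x"
    proof (cases "0 \<le> 10 * N + t")
      case True
      thus ?thesis using v by (simp add: xe)
    next
      case False
      hence "\<bar>10 * N + t\<bar> = - (10 * N + t)" by linarith
      thus ?thesis using v v' t2 unfolding xe prod.case by simp
    qed
    have "10 * N + t \<noteq> 0" using t(1) by presburger
    thus "(case x of (N, u) \<Rightarrow> (u, \<bar>10 * N + t\<bar>)) \<in> norm_reps m"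
      using u b[OF N, of u] rep[OF u(2)] by (simp add: xe norm_reps_def)
    show "(case case x of (N, u) \<Rightarrow> (u, \<bar>10 * N + t\<bar>) of (u, y) \<Rightarrow> sgn12 u * sgn60 y) = (case x of (N, u) \<Rightarrow> s N * sgn12 u)"
      by (simp add: xe s[OF N])
  next
    fix x assume x: "x \<in> norm_reps m"
    obtain u y where xe: "x = (u, y)" by (cases x)
    have uy: "0 < u" "0 < y" "3 * y < 5 * u" "odd u" "5 * u\<^sup>2 = y\<^sup>2 + 4 * m"
      using x by (auto simp: xe norm_reps_def)
    define N where "N = (if y mod 10 = t then y div 10 else (- y) div 10)"
    have y3: "odd y" "y mod 3 \<noteq> 0" using norm_form_coprime[OF uy(5) m] uy(4) by auto
    have "10 * N + t = y \<or> 10 * N + t = - y"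
    proof (cases "y mod 10 = t")
      case True
      thus ?thesis using div_mult_mod_eq[of y 10] by (simp add: N_def)
    next
      case False
      hence "(- y) mod 10 = t" using y_mod[OF uy(5) y3(1)] by simp
      thus ?thesis using False div_mult_mod_eq[of "- y" 10] by (simp add: N_def)
    qed
    hence abs: "\<bar>10 * N + t\<bar> = y" and sq: "(10 * N + t)\<^sup>2 = y\<^sup>2" and N3: "(10 * N + t) mod 3 \<noteq> 0"
      using uy(2) y3(2) by (auto simp: power2_eq_iff)
    have N2: "N mod 3 \<noteq> 2" using N3 t(2) by presburger
    show "(case case x of (u, y) \<Rightarrow> (if y mod 10 = t then y div 10 else (- y) div 10, u) of (N, u) \<Rightarrow> (u, \<bar>10 * N + t\<bar>)) = x"
      using abs by (simp add: xe N_def)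
    have "\<bar>N\<bar> \<le> K" using K[of N] norm_reps_bound[of u y m] x abs by (simp add: xe)
    hence "- K \<le> N" "N \<le> K + 1" by linarith+
    moreover have "b N < u"
      using b[OF N2, of u] uy abs norm_form_coprime(2)[OF uy(5) m] by simp
    ultimately show "(case x of (u, y) \<Rightarrow> (if y mod 10 = t then y div 10 else (- y) div 10, u)) \<in> (SIGMA N:?I. ?U N)"
      using N2 uy(5) sq by (simp add: xe N_def[symmetric])
  qed
  finally show ?thesis by (simp only: hecke_sum_def)
qed

theorem C0_hecke_sum: "C0 k = hecke_sum (30 * int k + 1)"
proof -
  define K where "K = 150 * k + 5"
  define m where "m = 30 * int k + 1"
  have "C0 k = (\<Sum>N\<in>{- int K..int K + 1}. fps_nth (hecke0 N) k)"
    by (rule C0_eq_hecke0) (simp add: K_def)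
  also have "\<dots> = (\<Sum>N | N \<in> {- int K..int K + 1} \<and> N mod 3 \<noteq> 2. fps_nth (hecke0 N) k)"
    by (rule sum.mono_neutral_right) (auto simp: hecke0_def schur_coeff_zero)
  also have "\<dots> = (\<Sum>N | N \<in> {- int K..int K + 1} \<and> N mod 3 \<noteq> 2. (sgn_int N * schur_sign N * (-1) ^ nat \<bar>N\<bar>) *
      (\<Sum>u | 6 * \<bar>N\<bar> < u \<and> 5 * u\<^sup>2 = (10 * N + 1)\<^sup>2 + 4 * m. sgn12 u))"
    by (intro sum.cong) (auto simp: hecke0_nth m_def)
  also have "\<dots> = hecke_sum m"
  proof (rule hecke_sum_regroup)
    show "m mod 3 = 1" unfolding m_def by presburger
    show "y mod 10 = 1 \<or> (- y) mod 10 = 1" if "5 * u\<^sup>2 = y\<^sup>2 + 4 * m" "odd y" for u y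
    proof -
      have "m mod 5 = 1" unfolding m_def by presburger
      with that show ?thesis by (intro odd_mod_10(1) norm_form_mod_5(1))
    qed
    \<comment> \<open>The cone amounts to u > 6N for N >= 0 and to u >= -6N for N < 0; the extra
      value -6N is a multiple of 3.\<close>
    show "6 * \<bar>N\<bar> < u \<longleftrightarrow> 0 < u \<and> 3 * \<bar>10 * N + 1\<bar> < 5 * u"
      if "N mod 3 \<noteq> 2" "odd u" "u mod 3 \<noteq> 0" for N u :: int
    proof (cases "0 \<le> N")
      case True
      thus ?thesis by auto
    next
      case False
      hence "u \<noteq> - 6 * N" using that(3) by auto
      thus ?thesis using False by auto
    qed
    show "\<bar>N\<bar> \<le> int K" if "\<bar>10 * N + 1\<bar> \<le> 5 * m" for N
      using that by (simp add: m_def K_def abs_le_iff)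
  qed (simp_all add: sgn60_class_1)
  finally show ?thesis by (simp only: m_def)
qed

theorem C1_hecke_sum: "C1 k = hecke_sum (30 * int k + 19)"
proof -
  define K where "K = 150 * k + 105"
  define m where "m = 30 * int k + 19"
  have "C1 k = (\<Sum>N\<in>{- int K..int K + 1}. - fps_nth (schur_coeff N * partial_theta (fold_index 1 N)) (Suc k))"
    unfolding sum_negf by (rule C1_eq_partial_theta) (auto simp: K_def)
  also have "\<dots> = (\<Sum>N | N \<in> {- int K..int K + 1} \<and> N mod 3 \<noteq> 2. - fps_nth (schur_coeff N * partial_theta (fold_index 1 N)) (Suc k))"
    by (rule sum.mono_neutral_right) (auto simp: schur_coeff_zero)
  also have "\<dots> = (\<Sum>N | N \<in> {- int K..int K + 1} \<and> N mod 3 \<noteq> 2. - (schur_sign N * (-1) ^ fold_index 1 N) *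
      (\<Sum>u | 6 * int (fold_index 1 N) + 1 < u \<and> 5 * u\<^sup>2 = (10 * N + 7)\<^sup>2 + 4 * m. sgn12 u))"
    using schur_coeff_partial_theta_nth by (intro sum.cong) (simp_all add: m_def)
  also have "\<dots> = hecke_sum m"
  proof (rule hecke_sum_regroup)
    show "m mod 3 = 1" unfolding m_def by presburger
    show "y mod 10 = 7 \<or> (- y) mod 10 = 7" if "5 * u\<^sup>2 = y\<^sup>2 + 4 * m" "odd y" for u y
    proof -
      have "m mod 5 = 4" unfolding m_def by presburger
      with that show ?thesis by (intro odd_mod_10(2) norm_form_mod_5(2))
    qed
    \<comment> \<open>For N >= 0 the cone means u >= 6N + 5, and the values 6N + 2 to 6N + 4 are not
      coprime to 6; for N < 0 both conditions say u >= -6N - 4.\<close>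
    show "6 * int (fold_index 1 N) + 1 < u \<longleftrightarrow> 0 < u \<and> 3 * \<bar>10 * N + 7\<bar> < 5 * u"
      if "N mod 3 \<noteq> 2" "odd u" "u mod 3 \<noteq> 0" for N u :: int
    proof (cases "0 \<le> N")
      case True
      have "u \<noteq> 6 * N + 2" "u \<noteq> 6 * N + 3" "u \<noteq> 6 * N + 4" using that(2,3) by auto
      thus ?thesis using True by (auto simp: fold_index_def)
    next
      case False
      thus ?thesis by (auto simp: fold_index_def)
    qed
    show "\<bar>N\<bar> \<le> int K" if "\<bar>10 * N + 7\<bar> \<le> 5 * m" for N
      using that by (simp add: m_def K_def abs_le_iff)
  qed (simp_all add: sgn60_class_7)
  finally show ?thesis by (simp only: m_def)
qed

section \<open>Scaling by an inert prime\<close>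

text \<open>By reciprocity (5/p) = (p/5), and p is 2 or 3 modulo 5.\<close>

lemma not_QuadRes_5:
  fixes p :: nat
  assumes "prime p" "p > 5" "p mod 10 = 3 \<or> p mod 10 = 7"
  shows "\<not> QuadRes (int p) 5"
proof
  assume "QuadRes (int p) 5"
  moreover have "\<not> [5 = 0] (mod int p)"
  proof
    assume "[5 = 0] (mod int p)"
    hence "int p dvd 5" by (simp add: cong_0_iff)
    hence "int p \<le> 5" by (rule zdvd_imp_le) simp
    thus False using assms(2) by simp
  qed
  ultimately have "Legendre 5 (int p) = 1" by (simp add: Legendre_def)
  moreover have "Legendre (int p) 5 = -1"
  proof -
    have p5: "int p mod 5 = 2 \<or> int p mod 5 = 3"
      using assms(3) by presburger
    hence "\<not> [int p = 0] (mod 5)" by (auto simp: cong_def)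
    moreover have "\<not> QuadRes 5 (int p)"
      using p5 by (auto simp: QuadRes_def cong_def square_mod_5 split: if_splits)
    ultimately show ?thesis by (simp add: Legendre_def)
  qed
  moreover have "Legendre (int p) (int 5) * Legendre (int 5) (int p) = (-1) ^ ((p - 1) div 2 * ((5 - 1) div 2))"
    using assms by (intro Quadratic_Reciprocity) auto
  ultimately show False by simp
qed

text \<open>If p did not divide u, then y/u would be a square root of 5 modulo p.\<close>

lemma inert_dvd:
  fixes p :: nat and u y :: int
  assumes "prime p" "p > 5" "p mod 10 = 3 \<or> p mod 10 = 7"
    and dvd: "int p dvd 5 * u\<^sup>2 - y\<^sup>2"
  shows "int p dvd u" "int p dvd y"
proof -
  have p: "prime (int p)" using assms(1) by simp
  show u: "int p dvd u"
  proof (rule ccontr)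
    assume "\<not> int p dvd u"
    hence "coprime u (int p)"
      using p by (metis coprime_commute prime_imp_coprime)
    then obtain w where w: "[u * w = 1] (mod int p)"
      using cong_solve_coprime_int by blast
    have "[y\<^sup>2 = 5 * u\<^sup>2] (mod int p)"
      using dvd by (metis cong_iff_dvd_diff cong_sym)
    hence "[y\<^sup>2 * w\<^sup>2 = 5 * u\<^sup>2 * w\<^sup>2] (mod int p)"
      by (rule cong_scalar_right)
    moreover have "[5 * (u * w)\<^sup>2 = 5 * 1\<^sup>2] (mod int p)"
      by (intro cong_scalar_left cong_pow w)
    ultimately have "[(y * w)\<^sup>2 = 5] (mod int p)"
      by (simp add: power_mult_distrib mult.assoc) (metis cong_trans)
    hence "QuadRes (int p) 5" by (auto simp: QuadRes_def)
    thus False using not_QuadRes_5[OF assms(1-3)] by simp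
  qed
  hence "int p dvd 5 * u\<^sup>2" by (simp add: power2_eq_square)
  hence "int p dvd y\<^sup>2" using dvd by (metis dvd_diff_right_iff)
  thus "int p dvd y" using p prime_dvd_power by blast
qed

text \<open>A solution would have u and y divisible by p, hence 4m = 5u^2 - y^2 divisible by
  p^2.\<close>

lemma norm_reps_empty:
  fixes p :: nat and m :: int
  assumes "prime p" "p > 5" "p mod 10 = 3 \<or> p mod 10 = 7"
    and "int p dvd m" "\<not> (int p)\<^sup>2 dvd m"
  shows "norm_reps m = {}"
proof safe
  fix u y assume "(u, y) \<in> norm_reps m"
  hence eq: "5 * u\<^sup>2 = y\<^sup>2 + 4 * m" by (simp add: norm_reps_def)
  hence "int p dvd 5 * u\<^sup>2 - y\<^sup>2" using assms(4) by simp
  from inert_dvd[OF assms(1-3) this] have "(int p)\<^sup>2 dvd u\<^sup>2" "(int p)\<^sup>2 dvd y\<^sup>2"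
    by (simp_all add: dvd_power_same)
  hence "(int p)\<^sup>2 dvd 5 * u\<^sup>2 - y\<^sup>2" by simp
  hence "(int p)\<^sup>2 dvd 4 * m" using eq by simp
  moreover have "coprime ((int p)\<^sup>2) 4"
  proof -
    have "odd p" using assms(3) by presburger
    hence "coprime ((int p)\<^sup>2) (2\<^sup>2)"
      by (simp only: coprime_power_left_iff coprime_power_right_iff coprime_right_2_iff_odd even_of_nat_iff) simp
    thus ?thesis by simp
  qed
  ultimately have "(int p)\<^sup>2 dvd m" by (simp add: coprime_dvd_mult_right_iff)
  thus "(u, y) \<in> {}" using assms(5) by simp
qed

lemma hecke_sum_eq_0:
  fixes p m :: nat
  assumes "prime p" "p > 5" "p mod 10 = 3 \<or> p mod 10 = 7" and "multiplicity p m = 1"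
  shows "hecke_sum (int m) = 0"
proof -
  have "m \<noteq> 0" using assms(4) by (metis multiplicity_zero zero_neq_one)
  hence "p dvd m" "\<not> p\<^sup>2 dvd m"
    using assms(1,4) power_dvd_iff_le_multiplicity[of m p 1] power_dvd_iff_le_multiplicity[of m p 2]
      prime_gt_1_nat[OF assms(1)]
    by auto
  hence "int p dvd int m" "\<not> (int p)\<^sup>2 dvd int m"
    by (simp_all flip: of_nat_power)
  thus ?thesis
    using norm_reps_empty[OF assms(1-3)] by (simp add: hecke_sum_def)
qed

lemma norm_reps_scale:
  fixes p :: nat and m :: int
  assumes "prime p" "p > 5" "p mod 10 = 3 \<or> p mod 10 = 7"
  shows "bij_betw (\<lambda>(u, y). (int p * u, int p * y)) (norm_reps m) (norm_reps ((int p)\<^sup>2 * m))"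
proof (rule bij_betw_imageI)
  have p: "0 < int p" "odd p" using assms(2,3) by (simp, presburger)
  show "inj_on (\<lambda>(u, y). (int p * u, int p * y)) (norm_reps m)"
    using p by (auto simp: inj_on_def)
  have iff: "(int p * u, int p * y) \<in> norm_reps ((int p)\<^sup>2 * m) \<longleftrightarrow> (u, y) \<in> norm_reps m" for u y
  proof -
    have "5 * (int p * u)\<^sup>2 = (int p * y)\<^sup>2 + 4 * ((int p)\<^sup>2 * m) \<longleftrightarrow>
       (int p)\<^sup>2 * (5 * u\<^sup>2) = (int p)\<^sup>2 * (y\<^sup>2 + 4 * m)"
      by (simp add: power_mult_distrib algebra_simps)
    also have "\<dots> \<longleftrightarrow> 5 * u\<^sup>2 = y\<^sup>2 + 4 * m" using p(1) by simp
    finally have 1: "5 * (int p * u)\<^sup>2 = (int p * y)\<^sup>2 + 4 * ((int p)\<^sup>2 * m) \<longleftrightarrow> 5 * u\<^sup>2 = y\<^sup>2 + 4 * m" .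
    have "3 * (int p * y) < 5 * (int p * u) \<longleftrightarrow> int p * (3 * y) < int p * (5 * u)"
      by (simp add: mult.left_commute)
    also have "\<dots> \<longleftrightarrow> 3 * y < 5 * u" using p(1) by simp
    finally have 2: "3 * (int p * y) < 5 * (int p * u) \<longleftrightarrow> 3 * y < 5 * u" .
    show ?thesis
      unfolding norm_reps_def mem_Collect_eq prod.case 1 2 using p by (auto simp: zero_less_mult_iff)
  qed
  show "(\<lambda>(u, y). (int p * u, int p * y)) ` norm_reps m = norm_reps ((int p)\<^sup>2 * m)"
  proof (intro equalityI subsetI)
    fix x assume "x \<in> (\<lambda>(u, y). (int p * u, int p * y)) ` norm_reps m"
    thus "x \<in> norm_reps ((int p)\<^sup>2 * m)" using iff by auto
  next
    fix x assume x: "x \<in> norm_reps ((int p)\<^sup>2 * m)"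
    obtain u y where xe: "x = (u, y)" by (cases x)
    have "5 * u\<^sup>2 - y\<^sup>2 = int p * (4 * int p * m)"
      using x by (simp add: xe norm_reps_def power2_eq_square)
    hence "int p dvd 5 * u\<^sup>2 - y\<^sup>2" by simp
    from inert_dvd[OF assms this] obtain u' y' where uy: "u = int p * u'" "y = int p * y'"
      by (auto elim!: dvdE)
    hence "(u', y') \<in> norm_reps m" using x iff by (simp add: xe)
    thus "x \<in> (\<lambda>(u, y). (int p * u, int p * y)) ` norm_reps m"
      using uy xe by force
  qed
qed

section \<open>The signs under multiplication by p\<close>

lemma sgn12_mult:
  assumes "odd a" "a mod 3 \<noteq> 0" "odd b" "b mod 3 \<noteq> 0"
  shows "sgn12 (a * b) = sgn12 a * sgn12 b"
proof -
  have mem: "x mod 12 \<in> {1, 5, 7, 11}" if "odd x" "x mod 3 \<noteq> 0" for x :: int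
    using that by simp presburger
  have sgn: "sgn12 x = (if x mod 12 \<in> {1, 11} then 1 else -1)" for x
    by (simp add: sgn12_def)
  have "(if (i * j) mod 12 \<in> {1, 11} then 1 else -1) =
      (if i \<in> {1, 11} then 1 else -1) * (if j \<in> {1, 11} then 1 else -1 :: rat)"
    if "i \<in> {1, 5, 7, 11}" "j \<in> {1, 5, 7, 11}" for i j :: int
    using that by (elim insertE emptyE; hypsubst; simp)
  from this[OF mem[OF assms(1,2)] mem[OF assms(3,4)]] show ?thesis
    unfolding sgn mod_mult_eq .
qed

text \<open>An equality of booleans encodes a product of signs.\<close>

lemma residue_table:
  "\<forall>r\<in>set [7 :: int, 13, 17, 23, 37, 43, 47, 53]. \<forall>s\<in>set [0..59]. odd s \<longrightarrow> s mod 3 \<noteq> 0 \<longrightarrow> s mod 5 \<noteq> 0 \<longrightarrow>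
     ((r mod 12 = 1 \<or> r mod 12 = 11) =
       (((r * s) mod 5 = 1 \<or> (r * s) mod 5 = 4) = ((r * s) mod 60 < 30)) \<longleftrightarrow>
      ((r mod 10 = 7) = (s mod 60 < 30)))"
  by code_simp

text \<open>Multiplication by p trades \<open>sgn60\<close> for the bare half-period sign. As
  neither is a character, the relation rests on a finite check of residues modulo 60.\<close>

lemma sgn60_scale:
  fixes p :: nat and y :: int
  assumes "prime p" "p > 5" "p mod 10 = 3 \<or> p mod 10 = 7"
    and "odd y" "y mod 3 \<noteq> 0" "y mod 5 \<noteq> 0"
  shows "sgn12 (int p) * sgn60 (int p * y) = eps p * (if y mod 60 < 30 then 1 else -1)"
proof -
  define r where "r = int p mod 60"
  define s where "s = y mod 60"
  have p3: "\<not> 3 dvd p"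
    using assms(1,2) primes_dvd_imp_eq[of 3 p] by auto
  have r_mod: "r mod 12 = int p mod 12" "r mod 10 = int p mod 10" "r mod 3 = int p mod 3"
    by (simp_all add: r_def mod_mod_cancel)
  have s_mod: "s mod 2 = y mod 2" "s mod 3 = y mod 3" "s mod 5 = y mod 5" "s mod 60 = y mod 60"
    by (simp_all add: s_def mod_mod_cancel)
  have mem: "r \<in> set [0..59]" "s \<in> set [0..59]" by (simp_all add: r_def s_def)
  have units: "\<forall>r\<in>set [0..59::int]. r mod 3 \<noteq> 0 \<longrightarrow> r mod 10 = 3 \<or> r mod 10 = 7 \<longrightarrow> r \<in> set [7, 13, 17, 23, 37, 43, 47, 53]"
    by code_simp
  have p10: "int p mod 10 = int (p mod 10)" by (simp add: zmod_int)
  have r10: "r mod 10 = 3 \<or> r mod 10 = 7"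
    using assms(3) unfolding r_mod p10 by auto
  have r3: "r mod 3 \<noteq> 0"
    using p3 unfolding r_mod by (metis mod_0_imp_dvd of_nat_dvd_iff of_nat_numeral)
  note r = units[rule_format, OF mem(1) r3 r10]
  have s: "odd s" "s mod 3 \<noteq> 0" "s mod 5 \<noteq> 0"
    unfolding odd_iff_mod_2_eq_one s_mod using assms(4-6) by (simp_all only: odd_iff_mod_2_eq_one not_False_eq_True)
  have rs: "(r * s) mod 60 = (int p * y) mod 60"
    by (simp add: r_def s_def mod_mult_eq)
  note rs5 = mod_60_imp_mod_5[OF rs]
  have signs: "(if A then 1 else -1) * ((if B then 1 else -1) * (if C then 1 else -1)) =
     (if D then 1 else -1) * (if H then 1 else -1 :: rat)" if "(A = (B = C)) = (D = H)" for A B C D H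
    using that by auto
  have eps: "eps p = (if int p mod 10 = 7 then 1 else -1)"
    using assms(3) unfolding p10 eps_def by auto
  show ?thesis
    unfolding sgn12_def sgn60_def eps
    by (rule signs, rule residue_table[rule_format, OF r mem(2) s, unfolded rs rs5 r_mod s_mod])
qed

text \<open>\<open>c\<close> is the value of (y/5), the same for all solutions because y^2 = m
  modulo 5; it turns the half-period sign back into \<open>sgn60\<close>.\<close>

lemma hecke_sum_scale:
  fixes p :: nat and m :: int and c :: rat
  assumes "prime p" "p > 5" "p mod 10 = 3 \<or> p mod 10 = 7"
    and m: "m mod 3 = 1" "m mod 5 = 1 \<and> c = 1 \<or> m mod 5 = 4 \<and> c = -1"
  shows "hecke_sum ((int p)\<^sup>2 * m) = c * eps p * hecke_sum m"
proof -
  have "hecke_sum ((int p)\<^sup>2 * m) = (\<Sum>(u, y)\<in>norm_reps m. sgn12 (int p * u) * sgn60 (int p * y))"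
    unfolding hecke_sum_def
    by (subst sum.reindex_bij_betw[OF norm_reps_scale[OF assms(1-3)], symmetric]) (simp add: case_prod_unfold)
  also have "\<dots> = (\<Sum>(u, y)\<in>norm_reps m. c * eps p * (sgn12 u * sgn60 y))"
  proof (intro sum.cong refl, clarify)
    fix u y assume uy: "(u, y) \<in> norm_reps m"
    hence eq: "5 * u\<^sup>2 = y\<^sup>2 + 4 * m" and u: "odd u" by (auto simp: norm_reps_def)
    note y = norm_form_coprime[OF eq m(1)]
    have c: "y mod 5 \<noteq> 0" "(if y mod 60 < 30 then 1 else -1) = c * sgn60 y"
      using norm_form_mod_5[OF eq] m(2) by (auto simp: sgn60_def)
    have "odd (int p)" "int p mod 3 \<noteq> 0"
    proof -
      show "odd (int p)" using assms(3) by simp presburger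
      have "\<not> 3 dvd p"
        using assms(1,2) primes_dvd_imp_eq[of 3 p] by auto
      thus "int p mod 3 \<noteq> 0" by (metis mod_0_imp_dvd of_nat_dvd_iff of_nat_numeral)
    qed
    hence "sgn12 (int p * u) = sgn12 (int p) * sgn12 u"
      using u y(2) by (intro sgn12_mult)
    thus "sgn12 (int p * u) * sgn60 (int p * y) = c * eps p * (sgn12 u * sgn60 y)"
      using sgn60_scale[OF assms(1-3), of y] u y c by (simp add: mult_ac)
  qed
  also have "\<dots> = c * eps p * hecke_sum m"
    by (simp add: hecke_sum_def sum_distrib_left case_prod_unfold)
  finally show ?thesis .
qed

theorem theorem5p5:
  fixes p :: nat
  assumes "prime p" and "p > 5" and "p mod 10 = 3 \<or> p mod 10 = 7"
  shows "(\<forall>n. multiplicity p (30 * n + 1) = 1 \<longrightarrow> C0 n = 0) \<and>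
         (\<forall>n. C0 (p\<^sup>2 * n + (19 * p\<^sup>2 - 1) div 30) = - eps p * C1 n) \<and>
         (\<forall>n. multiplicity p (30 * n + 19) = 1 \<longrightarrow> C1 n = 0) \<and>
         (\<forall>n. C1 (p\<^sup>2 * n + (p\<^sup>2 - 19) div 30) = eps p * C0 n)"
proof (intro conjI allI impI)
  fix n
  note shift = shift_exact[OF assms]
  show "C0 n = 0" if "multiplicity p (30 * n + 1) = 1"
    using hecke_sum_eq_0[OF assms that] by (simp add: C0_hecke_sum add.commute)
  show "C1 n = 0" if "multiplicity p (30 * n + 19) = 1"
    using hecke_sum_eq_0[OF assms that] by (simp add: C1_hecke_sum add.commute)
  have "30 * ((19 * p\<^sup>2 - 1) div 30) + 1 = 19 * p\<^sup>2" "30 * ((p\<^sup>2 - 19) div 30) + 19 = p\<^sup>2"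
    using shift by simp_all
  hence "30 * (p\<^sup>2 * n + (19 * p\<^sup>2 - 1) div 30) + 1 = p\<^sup>2 * (30 * n + 19)"
    and "30 * (p\<^sup>2 * n + (p\<^sup>2 - 19) div 30) + 19 = p\<^sup>2 * (30 * n + 1)"
    by (simp_all only: distrib_left)
  from this[THEN arg_cong[of _ _ int]]
  have eqs: "30 * int (p\<^sup>2 * n + (19 * p\<^sup>2 - 1) div 30) + 1 = (int p)\<^sup>2 * (30 * int n + 19)"
    "30 * int (p\<^sup>2 * n + (p\<^sup>2 - 19) div 30) + 19 = (int p)\<^sup>2 * (30 * int n + 1)"
    by (simp_all only: of_nat_add of_nat_mult of_nat_power of_nat_numeral of_nat_1)
  have "(30 * int n + 19) mod 3 = 1" "(30 * int n + 19) mod 5 = 4"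
    "(30 * int n + 1) mod 3 = 1" "(30 * int n + 1) mod 5 = 1"
    by presburger+
  \<comment> \<open>The minus sign for C_0 is the value c = -1 belonging to 30n + 19, which is 4
    modulo 5.\<close>
  thus "C0 (p\<^sup>2 * n + (19 * p\<^sup>2 - 1) div 30) = - eps p * C1 n"
    "C1 (p\<^sup>2 * n + (p\<^sup>2 - 19) div 30) = eps p * C0 n"
    unfolding C0_hecke_sum C1_hecke_sum eqs
    using hecke_sum_scale[OF assms, of "30 * int n + 19" "-1"] hecke_sum_scale[OF assms, of "30 * int n + 1" 1]
    by simp_all
qed

end
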